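(* Let $T>0$, $u,v_T\in\mathbb{R}$, $N\ge 0$, and let $b:\mathbb{R}\to\mathbb{R}$ be continuously differentiable with $b^2+b'$ bounded from below. Let $\xi_{i,j}$ and $\xi_{k,l}$ be two Faber–Schauder coefficients of levels $0\le i,k\le N$ (with $0\le j\le 2^i-1$, $0\le l\le 2^k-1$), and let $$A_{(i,j;k,l)}:=\{\xi_{h,d}:\ \xi_{h,d}\ll\xi_{k,l}\ \text{and}\ \xi_{h,d}\ll\xi_{i,j}\}$$ be the set of their common ancestors. If the interiors of the supports $S_{i,j}$ and $S_{k,l}$ of their basis functions are disjoint, that is, if neither $\xi_{i,j}\ll\xi_{k,l}$ nor $\xi_{k,l}\ll\xi_{i,j}$ holds, then under $\mathbb{P}^{u,v_T}_N$ the random variable $\xi_{i,j}$ is conditionally independent of $\xi_{k,l}$ given the random variables in $A_{(i,j;k,l)}$.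
   Context: Faber–Schauder functions on $[0,T]$: $\phi_{0,0}(t)=\sqrt{T}\left(\tfrac{t}{T}\mathbf 1_{[0,T/2]}(t)+(1-\tfrac{t}{T})\mathbf 1_{(T/2,T]}(t)\right)$ and $\phi_{i,j}(t)=2^{-i/2}\phi_{0,0}(2^it-jT)$ for $i=0,1,\dots$, $j=0,\dots,2^i-1$; the index $i$ is the level. The support of $\phi_{i,j}$ is $S_{i,j}=[\,jT2^{-i},(j+1)T2^{-i}\,]$. The relation $\xi_{i,j}\ll\xi_{k,l}$ holds iff $S_{k,l}\subset S_{i,j}$ (non-strict inclusion); then $\xi_{i,j}$ is called an ancestor of $\xi_{k,l}$ (each coefficient is an ancestor of itself). $\mathbb{Q}^{u,v_T}$ denotes the law on $C[0,T]$ of the Brownian bridge from $u$ at time $0$ to $v_T$ at time $T$. Every path $X\in C[0,T]$ with $X_0=u$, $X_T=v_T$ has a uniformly convergent expansion $X_t=(1-\tfrac tT)u+\tfrac tT v_T+\sum_{i\ge0}\sum_{j=0}^{2^i-1}\xi_{i,j}\phi_{i,j}(t)$; the coefficients $\xi_{i,j}=\xi_{i,j}(X)$ are regarded as random variables on $C[0,T]$, and under $\mathbb{Q}^{u,v_T}$ they are independent standard normal. The truncated path is $$X^N_t=(1-\tfrac tT)u+\tfrac tT v_T+\sum_{i=0}^{N}\sum_{j=0}^{2^i-1}\xi_{i,j}\phi_{i,j}(t).$$ Put $B(x)=\int_0^x b(s)\,\mathrm{d}s$ and $Z^N(X)=\exp\left(B(X^N_T)-B(X^N_0)-\tfrac12\int_0^T\left[b^2(X^N_s)+b'(X^N_s)\right]\mathrm{d}s\right)$.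 The approximated diffusion bridge measure $\mathbb{P}^{u,v_T}_N$ on $C[0,T]$ (for the diffusion $\mathrm{d}X_t=b(X_t)\,\mathrm{d}t+\mathrm{d}W_t$, $X_0=u$, conditioned on $X_T=v_T$) is defined by $$\frac{\mathrm{d}\mathbb{P}^{u,v_T}_N}{\mathrm{d}\mathbb{Q}^{u,v_T}}(X)=\frac{Z^N(X)}{c^{v_T}_N},\qquad c^{v_T}_N=\mathbb{E}_{\mathbb{Q}^{u,v_T}}\left[Z^N(X)\right].$$ *)

theory Defs
  imports "HOL-Probability.Probability"
begin

section \<open>The Faber--Schauder system on the interval from 0 to T\<close>

definition fs_mother :: "real \<Rightarrow> real \<Rightarrow> real" where
  "fs_mother T t =
     sqrt T * (t / T * indicator {0..T/2} t + (1 - t / T) * indicator {T/2<..T} t)"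

definition fs_fun :: "real \<Rightarrow> nat \<Rightarrow> nat \<Rightarrow> real \<Rightarrow> real" where
  "fs_fun T i j t = 2 powr (- real i / 2) * fs_mother T (2 ^ i * t - real j * T)"

definition fs_support :: "real \<Rightarrow> nat \<Rightarrow> nat \<Rightarrow> real set" where
  "fs_support T i j = {real j * T / 2 ^ i .. (real j + 1) * T / 2 ^ i}"

text \<open>The relation \<open>\<xi>\<^sub>i\<^sub>j \<lless> \<xi>\<^sub>k\<^sub>l\<close>, stated on the indices; it is reflexive.\<close>

definition fs_ancestor :: "real \<Rightarrow> nat \<times> nat \<Rightarrow> nat \<times> nat \<Rightarrow> bool" where
  "fs_ancestor T p q \<longleftrightarrow>
     fs_support T (fst q) (snd q) \<subseteq> fs_support T (fst p) (snd p)"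

definition common_ancestors :: "real \<Rightarrow> nat \<times> nat \<Rightarrow> nat \<times> nat \<Rightarrow> (nat \<times> nat) set" where
  "common_ancestors T p q =
     {(h, d). d < 2 ^ h \<and> fs_ancestor T (h, d) q \<and> fs_ancestor T (h, d) p}"

definition fs_partial :: "real \<Rightarrow> real \<Rightarrow> real \<Rightarrow> (nat \<Rightarrow> nat \<Rightarrow> real) \<Rightarrow> nat \<Rightarrow> real \<Rightarrow> real" where
  "fs_partial T u v \<xi> N t =
     (1 - t / T) * u + t / T * v + (\<Sum>i\<le>N. \<Sum>j<2 ^ i. \<xi> i j * fs_fun T i j t)"

text \<open>
  The coefficients of a continuous path on \<open>{0..T}\<close> are those of its uniformly convergent
  Faber--Schauder expansion, with the end points read off from the path itself. The
  requirement that \<open>\<xi> i j = 0\<close> for \<open>j \<ge> 2 ^ i\<close> only fixes the values at index pairs that do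
  not belong to the system, so that the coefficient function is unique.
\<close>

definition fs_coeff :: "real \<Rightarrow> (real \<Rightarrow> real) \<Rightarrow> nat \<Rightarrow> nat \<Rightarrow> real" where
  "fs_coeff T X = (THE \<xi>. (\<forall>i j. 2 ^ i \<le> j \<longrightarrow> \<xi> i j = 0) \<and>
     uniform_limit {0..T} (fs_partial T (X 0) (X T) \<xi>) X sequentially)"

lemma interior_fs_support:
  "interior (fs_support T i j) = {real j * T / 2 ^ i <..< (real j + 1) * T / 2 ^ i}"
  by (simp add: fs_support_def)

lemma fs_support_dichotomy_le:
  fixes T :: real
  assumes T: "T > 0" and ik: "i \<le> k"
  shows "fs_support T k l \<subseteq> fs_support T i j \<or>
         interior (fs_support T i j) \<inter> interior (fs_support T k l) = {}"
proof -
  define m where "m = k - i"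
  have k: "(2::real) ^ k = 2 ^ i * 2 ^ m"
    using ik by (simp add: m_def flip: power_add)
  have scale: "real a * T / 2 ^ i = real (a * 2 ^ m) * T / 2 ^ k" for a
    by (simp add: k)
  have le: "real a * T / 2 ^ k \<le> real b * T / 2 ^ k" if "a \<le> b" for a b
    using that T by (intro divide_right_mono mult_right_mono) auto
  have suc: "(real a + 1) * T / 2 ^ n = real (Suc a) * T / 2 ^ n" for a n
    by (simp add: add.commute)
  consider "Suc l \<le> j * 2 ^ m" | "Suc j * 2 ^ m \<le> l"
    | "j * 2 ^ m \<le> l" "Suc l \<le> Suc j * 2 ^ m"
    by linarith
  then show ?thesis
  proof cases
    case 1
    then have "(real l + 1) * T / 2 ^ k \<le> real j * T / 2 ^ i"
      unfolding suc scale by (rule le)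
    then show ?thesis
      unfolding interior_fs_support by auto
  next
    case 2
    then have "(real j + 1) * T / 2 ^ i \<le> real l * T / 2 ^ k"
      unfolding suc scale by (rule le)
    then show ?thesis
      unfolding interior_fs_support by auto
  next
    case 3
    have "real j * T / 2 ^ i \<le> real l * T / 2 ^ k"
      unfolding scale using 3(1) by (rule le)
    moreover have "(real l + 1) * T / 2 ^ k \<le> (real j + 1) * T / 2 ^ i"
      unfolding suc scale using 3(2) by (rule le)
    ultimately show ?thesis
      unfolding fs_support_def by auto
  qed
qed

lemma interior_fs_support_nonempty:
  assumes "T > 0"
  shows "interior (fs_support T i j) \<noteq> {}"
proof -
  have "real j * T / 2 ^ i < (real j + 1) * T / 2 ^ i"
    using assms by (intro divide_strict_right_mono mult_strict_right_mono) auto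
  then show ?thesis
    unfolding interior_fs_support greaterThanLessThan_empty_iff by simp
qed

lemma fs_interiors_disjoint_iff:
  assumes T: "T > 0"
  shows "interior (fs_support T i j) \<inter> interior (fs_support T k l) = {} \<longleftrightarrow>
         \<not> fs_ancestor T (i, j) (k, l) \<and> \<not> fs_ancestor T (k, l) (i, j)"
proof -
  have "\<not> fs_ancestor T (i, j) (k, l)"
    if "interior (fs_support T i j) \<inter> interior (fs_support T k l) = {}" for i j k l
    using that interior_mono[of "fs_support T k l" "fs_support T i j"]
      interior_fs_support_nonempty[OF T, of k l]
    by (auto simp: fs_ancestor_def)
  moreover have "fs_ancestor T (i, j) (k, l) \<or> fs_ancestor T (k, l) (i, j)"
    if "interior (fs_support T i j) \<inter> interior (fs_support T k l) \<noteq> {}"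
    using that fs_support_dichotomy_le[OF T, of i k l j] fs_support_dichotomy_le[OF T, of k i j l]
    by (cases "i \<le> k") (auto simp: fs_ancestor_def)
  ultimately show ?thesis
    by (metis Int_commute)
qed


section \<open>The law of the Brownian bridge\<close>

text \<open>
  \<open>C[0,T]\<close> with the sigma-algebra generated by the evaluations, which is also the Borel
  sigma-algebra of the uniform norm. As everywhere for product measures, a path is
  \<open>undefined\<close> outside \<open>{0..T}\<close>.
\<close>

definition path_space :: "real \<Rightarrow> (real \<Rightarrow> real) measure" where
  "path_space T = restrict_space (Pi\<^sub>M {0..T} (\<lambda>_. borel)) {X. continuous_on {0..T} X}"

definition wiener_measure :: "real \<Rightarrow> (real \<Rightarrow> real) measure \<Rightarrow> bool" where
  "wiener_measure T W \<longleftrightarrow>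
     prob_space W \<and> sets W = sets (path_space T) \<and>
     (AE X in W. X 0 = 0) \<and>
     (\<forall>s t. 0 \<le> s \<and> s < t \<and> t \<le> T \<longrightarrow>
        distributed W lborel (\<lambda>X. X t - X s) (normal_density 0 (sqrt (t - s)))) \<and>
     (\<forall>n (t :: nat \<Rightarrow> real). 0 \<le> t 0 \<and> (\<forall>m<n. t m < t (Suc m)) \<and> t n \<le> T \<longrightarrow>
        prob_space.indep_vars W (\<lambda>_. borel) (\<lambda>m X. X (t (Suc m)) - X (t m)) {..<n})"

text \<open>
  The Brownian bridge from \<open>u\<close> to \<open>v\<close> is the process
  \<open>(1 - t / T) u + (t / T) v + W\<^sub>t - (t / T) W\<^sub>T\<close> for a Brownian motion \<open>W\<close>. It has a unique law.
\<close>

definition brownian_bridge_law :: "real \<Rightarrow> real \<Rightarrow> real \<Rightarrow> (real \<Rightarrow> real) measure \<Rightarrow> bool" where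
  "brownian_bridge_law T u v Q \<longleftrightarrow>
     (\<exists>W. wiener_measure T W \<and>
        Q = distr W (path_space T)
              (\<lambda>X. \<lambda>t\<in>{0..T}. (1 - t / T) * u + t / T * v + (X t - t / T * X T)))"


section \<open>The approximated diffusion bridge\<close>

definition truncated_path :: "real \<Rightarrow> real \<Rightarrow> real \<Rightarrow> nat \<Rightarrow> (real \<Rightarrow> real) \<Rightarrow> real \<Rightarrow> real" where
  "truncated_path T u v N X = fs_partial T u v (fs_coeff T X) N"

definition drift_potential :: "(real \<Rightarrow> real) \<Rightarrow> real \<Rightarrow> real" where
  "drift_potential b x = (LBINT s=ereal 0..ereal x. b s)"

definition bridge_weight ::
  "real \<Rightarrow> real \<Rightarrow> real \<Rightarrow> (real \<Rightarrow> real) \<Rightarrow> nat \<Rightarrow> (real \<Rightarrow> real) \<Rightarrow> real" where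
  "bridge_weight T u v b N X =
     exp (drift_potential b (truncated_path T u v N X T)
          - drift_potential b (truncated_path T u v N X 0)
          - 1 / 2 * (LBINT s=ereal 0..ereal T.
              (b (truncated_path T u v N X s))\<^sup>2 + deriv b (truncated_path T u v N X s)))"

text \<open>\<open>Q\<close> stands for the law of the Brownian bridge from \<open>u\<close> to \<open>v\<close>.\<close>

definition approx_bridge ::
  "real \<Rightarrow> real \<Rightarrow> real \<Rightarrow> (real \<Rightarrow> real) \<Rightarrow> nat \<Rightarrow> (real \<Rightarrow> real) measure \<Rightarrow> (real \<Rightarrow> real) measure" where
  "approx_bridge T u v b N Q =
     density Q (\<lambda>X. ennreal (bridge_weight T u v b N X / (\<integral>Y. bridge_weight T u v b N Y \<partial>Q)))"


section \<open>Conditional independence\<close>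

definition generated_by :: "'a measure \<Rightarrow> 'i set \<Rightarrow> ('i \<Rightarrow> 'a \<Rightarrow> real) \<Rightarrow> 'a measure" where
  "generated_by M I Z =
     vimage_algebra (space M) (\<lambda>\<omega>. \<lambda>p\<in>I. Z p \<omega>) (Pi\<^sub>M I (\<lambda>_. borel))"

text \<open>
  \<^const>\<open>real_cond_exp\<close> is only meaningful for a sub-sigma-algebra and integrable functions,
  whence the first four conditions.
\<close>

definition cond_indep_var ::
  "'a measure \<Rightarrow> 'a measure \<Rightarrow> ('a \<Rightarrow> real) \<Rightarrow> ('a \<Rightarrow> real) \<Rightarrow> bool" where
  "cond_indep_var M F X Y \<longleftrightarrow>
     prob_space M \<and> subalgebra M F \<and> X \<in> borel_measurable M \<and> Y \<in> borel_measurable M \<and>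
     (\<forall>A\<in>sets borel. \<forall>B\<in>sets borel. AE \<omega> in M.
        real_cond_exp M F (indicator {\<omega>\<in>space M. X \<omega> \<in> A \<and> Y \<omega> \<in> B}) \<omega> =
        real_cond_exp M F (indicator {\<omega>\<in>space M. X \<omega> \<in> A}) \<omega> *
        real_cond_exp M F (indicator {\<omega>\<in>space M. Y \<omega> \<in> B}) \<omega>)"

end

theory Submission
  imports Defs
begin

text \<open>
  The coefficient \<open>\<xi>\<^sub>i\<^sub>j\<close> is a scaled second difference of the path over its support, so the
  coefficients arise from the independent normal increments over a dyadic grid by repeatedly
  replacing neighbours by their sum and difference; hence they are independent under the bridge law.
  Let \<open>n\<close> be the ancestor of \<open>\<xi>\<^sub>i\<^sub>j\<close> of lowest level that is not an ancestor of \<open>\<xi>\<^sub>k\<^sub>l\<close>, and \<open>D\<close> the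
  set of its descendants. Splitting the integral in the weight over the support of \<open>n\<close> and its
  complement writes the density as \<open>f(\<xi>\<^sub>A, \<xi>\<^sub>D) g(\<xi>\<^sub>E)\<close>, where \<open>A\<close> is the set of common ancestors and
  \<open>E\<close> the complement of \<open>D\<close>, which contains \<open>A\<close>. As \<open>\<xi>\<^sub>D\<close> and \<open>\<xi>\<^sub>E\<close> are independent under the bridge law,
  the conditional law of \<open>\<xi>\<^sub>D\<close> given \<open>\<xi>\<^sub>E\<close> under the new measure depends on \<open>\<xi>\<^sub>A\<close> only.
\<close>

section \<open>The coefficients as second differences\<close>

text \<open>The coefficients are defined by a description operator over uniformly convergent
  expansions, while the Wiener measure is known only through its increments. The second difference
  formula closes this gap: each coefficient becomes a combination of three path values that is blind
  to affine terms, so pinning the end point leaves it unchanged. Sums and differences of neighbours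
  stay independent because the two increments are Gaussian with the same variance, the mesh of the
  grid. The level of \<open>n\<close> matters for the factorization: a basis function that is active
  on the support of \<open>n\<close> without descending from it must be a common ancestor, and a
  separating node further down could leave others. The lower bound on b^2 + b' makes both factors
  bounded, hence integrable, and their positivity makes all normalizing constants nonzero.\<close>

definition tent :: "real \<Rightarrow> real" where
  "tent x = max 0 (min x (1 - x))"

text \<open>In the cell variable 2^i t/T - j every basis function is a multiple of one hat on [0, 1]
  with peak 1/2. The clipped minimum makes continuity and vanishing off the support
  immediate.\<close>

lemma fs_fun_eq_tent:
  assumes "T > 0"
  shows "fs_fun T i j t = 2 powr (- real i / 2) * sqrt T * tent (2 ^ i * (t / T) - real j)"
proof -
  have *: "(2 ^ i * t - real j * T) / T = 2 ^ i * (t / T) - real j"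
    using assms by (simp add: diff_divide_distrib)
  have "fs_mother T s = sqrt T * tent (s / T)" for s
    using assms by (auto simp: fs_mother_def tent_def indicator_def max_def min_def field_simps)
  then show ?thesis
    unfolding fs_fun_def by (simp add: *)
qed

lemma tent_eq_0: "x \<le> 0 \<or> 1 \<le> x \<Longrightarrow> tent x = 0"
  by (auto simp: tent_def)

lemma continuous_on_tent [continuous_intros]:
  "continuous_on S f \<Longrightarrow> continuous_on S (\<lambda>x. tent (f x))"
  unfolding tent_def by (intro continuous_intros)

lemma continuous_on_fs_fun:
  assumes "T > 0" shows "continuous_on S (fs_fun T i j)"
  unfolding fs_fun_eq_tent[OF assms, abs_def] using assms by (intro continuous_intros) auto

lemma tent_int: "tent (real a - real b) = 0"
proof -
  have "real a \<le> real b \<or> real b + 1 \<le> real a"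
    by (cases "a \<le> b") linarith+
  then show ?thesis by (intro tent_eq_0) auto
qed

text \<open>A grid point of level \<open>n\<close> is also one of every finer level
  \<open>i\<close>, where the cell variable is an integer and the hat is zero. Hence later levels
  never disturb values attained on a coarser grid.\<close>

lemma fs_fun_dyadic_eq_0:
  assumes "T > 0" "n \<le> i"
  shows "fs_fun T i j (real m * T / 2 ^ n) = 0"
proof -
  have "(2::real) ^ i = 2 ^ (i - n) * 2 ^ n"
    using assms by (simp flip: power_add)
  then have "2 ^ i * (real m * T / 2 ^ n / T) - real j = real (2 ^ (i - n) * m) - real j"
    using assms by simp
  then show ?thesis
    using assms by (simp add: fs_fun_eq_tent tent_int del: of_nat_mult of_nat_power)
qed

lemma fs_fun_support:
  assumes "T > 0" "t \<notin> interior (fs_support T i j)"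
  shows "fs_fun T i j t = 0"
proof -
  have "2 ^ i * (t / T) - real j \<le> 0 \<or> 1 \<le> 2 ^ i * (t / T) - real j"
    using assms unfolding interior_fs_support by (auto simp: field_simps)
  then show ?thesis
    using assms by (simp add: fs_fun_eq_tent tent_eq_0)
qed

section \<open>Piecewise linearity on dyadic cells\<close>

definition affine_on_cell :: "real \<Rightarrow> nat \<Rightarrow> nat \<Rightarrow> (real \<Rightarrow> real) \<Rightarrow> bool" where
  "affine_on_cell T n m f \<longleftrightarrow> (\<exists>c d. \<forall>t\<in>fs_support T n m. f t = c + d * t)"

lemma affine_on_cell_add:
  "affine_on_cell T n m f \<Longrightarrow> affine_on_cell T n m g \<Longrightarrow> affine_on_cell T n m (\<lambda>t. f t + g t)"
  unfolding affine_on_cell_def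
proof (elim exE)
  fix c d c' d'
  assume "\<forall>t\<in>fs_support T n m. f t = c + d * t" "\<forall>t\<in>fs_support T n m. g t = c' + d' * t"
  then show "\<exists>c d. \<forall>t\<in>fs_support T n m. f t + g t = c + d * t"
    by (intro exI[of _ "c + c'"] exI[of _ "d + d'"]) (simp add: algebra_simps)
qed

lemma affine_on_cell_cmult:
  assumes "affine_on_cell T n m f" shows "affine_on_cell T n m (\<lambda>t. a * f t)"
proof -
  obtain c d where "\<forall>t\<in>fs_support T n m. f t = c + d * t"
    using assms unfolding affine_on_cell_def by blast
  then show ?thesis
    unfolding affine_on_cell_def
    by (intro exI[of _ "a * c"] exI[of _ "a * d"]) (simp add: algebra_simps)
qed

lemma affine_on_cell_sum:
  "(\<And>i. i \<in> I \<Longrightarrow> affine_on_cell T n m (f i)) \<Longrightarrow> affine_on_cell T n m (\<lambda>t. \<Sum>i\<in>I. f i t)"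
proof (induction I rule: infinite_finite_induct)
  case (insert x F)
  then show ?case by (simp add: affine_on_cell_add)
qed (auto simp: affine_on_cell_def intro!: exI[of _ 0])

text \<open>A hat of level \<open>i\<close> is affine on each half of its cell and zero elsewhere,
  thus affine on every cell of level i + 1; a finer cell lies inside one of these. As
  \<open>m\<close> is unrestricted, the cell may lie outside the interval from 0 to T.\<close>

lemma affine_on_cell_fs_fun:
  assumes T: "T > 0" and "i < n"
  shows "affine_on_cell T n m (fs_fun T i j)"
proof -
  define e where "e = n - i - 1"
  \<comment> \<open>The number of the cell of level i + 1 that contains cell \<open>m\<close> of
    level \<open>n\<close>; it consists of 2^e cells of level \<open>n\<close>.\<close>
  define q where "q = m div 2 ^ e"
  have n: "n = i + Suc e" using assms by (simp add: e_def)
  have q: "q * 2 ^ e \<le> m" "m + 1 \<le> (q + 1) * 2 ^ e"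
  proof -
    show "q * 2 ^ e \<le> m" by (simp add: q_def)
    have "m < (q + 1) * 2 ^ e"
      unfolding q_def using dividend_less_div_times[of "2 ^ e" m] by (simp add: algebra_simps)
    then show "m + 1 \<le> (q + 1) * 2 ^ e" by simp
  qed
  have qr: "real q * 2 ^ e \<le> real m" "real m + 1 \<le> (real q + 1) * 2 ^ e"
    using q[THEN of_nat_mono[where 'a=real]] by (simp_all add: algebra_simps)
  define y where "y = (\<lambda>t. 2 ^ i * (t / T) - real j)"
  have bnd: "real q \<le> 2 * y t + 2 * real j" "2 * y t + 2 * real j \<le> real q + 1"
    if "t \<in> fs_support T n m" for t
  proof -
    have t: "real m \<le> t / T * 2 ^ n" "t / T * 2 ^ n \<le> real m + 1"
      using that T by (auto simp: fs_support_def field_simps)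
    have eq: "t / T * 2 ^ n = (2 * y t + 2 * real j) * 2 ^ e"
      by (simp add: y_def n power_add algebra_simps)
    have "real q * 2 ^ e \<le> (2 * y t + 2 * real j) * 2 ^ e"
      using qr t unfolding eq by linarith
    then show "real q \<le> 2 * y t + 2 * real j" by (subst (asm) mult_le_cancel_right_pos) auto
    have "(2 * y t + 2 * real j) * 2 ^ e \<le> (real q + 1) * 2 ^ e"
      using qr t unfolding eq by linarith
    then show "2 * y t + 2 * real j \<le> real q + 1" by (subst (asm) mult_le_cancel_right_pos) auto
  qed
  have "affine_on_cell T n m (\<lambda>t. tent (y t))"
  proof -
    \<comment> \<open>The cell lies off the support, on the rising half of the hat, or on the
      falling half.\<close>
    have "q + 1 \<le> 2 * j \<or> 2 * j + 2 \<le> q \<or> q = 2 * j \<or> q = 2 * j + 1" by linarith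
    then consider "real q + 1 \<le> 2 * real j \<or> 2 * real j + 2 \<le> real q" | "real q = 2 * real j"
      | "real q = 2 * real j + 1"
      by force
    then show ?thesis
    proof cases
      case 1
      have "tent (y t) = 0" if "t \<in> fs_support T n m" for t
      proof (rule tent_eq_0)
        show "y t \<le> 0 \<or> 1 \<le> y t"
          using bnd[OF that] 1 by linarith
      qed
      then show ?thesis unfolding affine_on_cell_def by (intro exI[of _ 0]) auto
    next
      case 2
      have "tent (y t) = - real j + 2 ^ i / T * t" if "t \<in> fs_support T n m" for t
      proof -
        have "tent (y t) = y t"
          using bnd[OF that] 2 unfolding tent_def by linarith
        then show ?thesis by (simp add: y_def)
      qed
      then show ?thesis unfolding affine_on_cell_def by blast
    next
      case 3
      have "tent (y t) = (1 + real j) + (- (2 ^ i / T)) * t" if "t \<in> fs_support T n m" for t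
      proof -
        have "tent (y t) = 1 - y t"
          using bnd[OF that] 3 unfolding tent_def by linarith
        then show ?thesis by (simp add: y_def)
      qed
      then show ?thesis unfolding affine_on_cell_def by blast
    qed
  qed
  then show ?thesis
    unfolding fs_fun_eq_tent[OF T] y_def by (rule affine_on_cell_cmult)
qed

lemma affine_on_cell_linear: "affine_on_cell T n m (\<lambda>t. (1 - t / T) * u + t / T * v)"
  unfolding affine_on_cell_def
  by (intro exI[of _ u] exI[of _ "(v - u) / T"]) (simp add: diff_divide_distrib algebra_simps)

lemma affine_on_cell_fs_partial:
  assumes "T > 0" "N < n"
  shows "affine_on_cell T n m (fs_partial T u v \<xi> N)"
proof -
  have "affine_on_cell T n m (\<lambda>t. \<Sum>i\<le>N. \<Sum>j<2 ^ i. \<xi> i j * fs_fun T i j t)"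
    using assms by (intro affine_on_cell_sum affine_on_cell_cmult affine_on_cell_fs_fun) auto
  then show ?thesis
    unfolding fs_partial_def by (rule affine_on_cell_add[OF affine_on_cell_linear])
qed

lemma dyadic_point_in:
  assumes "T > 0" "m \<le> 2 ^ n" shows "real m * T / 2 ^ n \<in> {0..T}"
proof -
  have "real m \<le> 2 ^ n" using assms by (metis of_nat_le_iff of_nat_numeral of_nat_power)
  then show ?thesis using assms by (auto simp: field_simps)
qed

section \<open>Second differences and interpolation on the dyadic grid\<close>

definition dyadic_diff :: "real \<Rightarrow> (real \<Rightarrow> real) \<Rightarrow> nat \<Rightarrow> nat \<Rightarrow> real" where
  "dyadic_diff T X h d =
     2 * X (real (2 * d + 1) * T / 2 ^ Suc h) - X (real d * T / 2 ^ h) - X (real (d + 1) * T / 2 ^ h)"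

lemma dyadic_double: "real (2 * d) * T / 2 ^ Suc h = real d * T / 2 ^ h"
  by simp

text \<open>Up to the factor 2, \<open>dyadic_diff\<close> is the deviation at the midpoint of a
  cell from the chord over that cell.\<close>

lemma dyadic_diff_affine:
  assumes "T > 0" "affine_on_cell T h d f"
  shows "dyadic_diff T f h d = 0"
proof -
  obtain c e where *: "\<And>t. t \<in> fs_support T h d \<Longrightarrow> f t = c + e * t"
    using assms unfolding affine_on_cell_def by blast
  have "real (2 * d + 1) * T / 2 ^ Suc h \<in> fs_support T h d"
    "real d * T / 2 ^ h \<in> fs_support T h d" "real (d + 1) * T / 2 ^ h \<in> fs_support T h d"
    using assms(1) by (auto simp: fs_support_def field_simps)
  then show ?thesis
    unfolding dyadic_diff_def by (simp add: * field_simps)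
qed

lemma fs_fun_same_level_mid:
  assumes "T > 0"
  shows "fs_fun T h j (real (2 * d + 1) * T / 2 ^ Suc h)
    = (if j = d then 2 powr (- real h / 2) * sqrt T / 2 else 0)"
proof -
  have *: "2 ^ h * (real (2 * d + 1) * T / 2 ^ Suc h / T) - real j = real d - real j + 1 / 2"
    using assms by (simp add: field_simps)
  have "tent (real d - real j + 1 / 2) = (if j = d then 1/2 else 0)"
  proof -
    have "j = d \<or> real d + 1 \<le> real j \<or> real j + 1 \<le> real d" by linarith
    then show ?thesis by (auto simp: tent_def)
  qed
  then show ?thesis
    unfolding fs_fun_eq_tent[OF assms] * by simp
qed

lemma dyadic_diff_cong:
  assumes "\<And>m. m \<le> 2 ^ Suc h \<Longrightarrow> X (real m * T / 2 ^ Suc h) = Y (real m * T / 2 ^ Suc h)"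
    and "d < 2 ^ h"
  shows "dyadic_diff T X h d = dyadic_diff T Y h d"
proof -
  have "2 * d + 1 \<le> 2 ^ Suc h" "2 * d \<le> 2 ^ Suc h" "2 * (d + 1) \<le> 2 ^ Suc h"
    using assms(2) by auto
  from this[THEN assms(1)] show ?thesis
    unfolding dyadic_diff_def dyadic_double by simp
qed

lemma fs_partial_Suc:
  "fs_partial T u v \<xi> (Suc N) t = fs_partial T u v \<xi> N t + (\<Sum>j<2 ^ Suc N. \<xi> (Suc N) j * fs_fun T (Suc N) j t)"
  unfolding fs_partial_def by simp

lemma fs_partial_0:
  "fs_partial T u v \<xi> 0 t = ((1 - t / T) * u + t / T * v) + (\<Sum>j<2 ^ 0. \<xi> 0 j * fs_fun T 0 j t)"
  unfolding fs_partial_def by simp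

text \<open>At the end points of the cell all hats of level \<open>h\<close> vanish, and at its
  midpoint only hat \<open>d\<close> is nonzero, with value 2^(-h/2) sqrt T / 2. The second
  difference doubles this value and annihilates the affine part.\<close>

lemma dyadic_diff_add_level:
  assumes T: "T > 0" and d: "d < 2 ^ h" and f: "affine_on_cell T h d f"
  shows "dyadic_diff T (\<lambda>t. f t + (\<Sum>j<2 ^ h. \<xi> j * fs_fun T h j t)) h d = \<xi> d * (2 powr (- real h / 2) * sqrt T)"
proof -
  let ?g = "\<lambda>t. \<Sum>j<2 ^ h. \<xi> j * fs_fun T h j t"
  have 0: "?g (real d * T / 2 ^ h) = 0" "?g (real (d+1) * T / 2 ^ h) = 0"
    using fs_fun_dyadic_eq_0[OF T order_refl, of h _ d] fs_fun_dyadic_eq_0[OF T order_refl, of h _ "d+1"]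
    by auto
  have m: "?g (real (2 * d + 1) * T / 2 ^ Suc h) = \<xi> d * (2 powr (- real h / 2) * sqrt T / 2)"
    using d unfolding fs_fun_same_level_mid[OF T]
    by (simp add: if_distrib[of "\<lambda>x. _ * x"] sum.delta' cong: if_cong)
  have "dyadic_diff T (\<lambda>t. f t + ?g t) h d = dyadic_diff T f h d + dyadic_diff T ?g h d"
    unfolding dyadic_diff_def by (simp add: algebra_simps)
  also have "\<dots> = dyadic_diff T ?g h d" using dyadic_diff_affine[OF T f] by simp
  also have "\<dots> = \<xi> d * (2 powr (- real h / 2) * sqrt T)"
    unfolding dyadic_diff_def 0 m by simp
  finally show ?thesis .
qed

text \<open>All lower levels are affine on a cell of level \<open>h\<close>, so only the coefficient
  of that cell survives. At level 0 the linear interpolation of the end values takes the place of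
  the lower levels.\<close>

lemma dyadic_diff_fs_partial:
  assumes T: "T > 0" and d: "d < 2 ^ h"
  shows "dyadic_diff T (fs_partial T u v \<xi> h) h d = \<xi> h d * (2 powr (- real h / 2) * sqrt T)"
proof (cases h)
  case 0
  then show ?thesis
    using dyadic_diff_add_level[OF T _ affine_on_cell_linear, of d 0 u v "\<xi> 0"] d
    by (simp add: fs_partial_0[abs_def])
next
  case (Suc n)
  then show ?thesis
    using dyadic_diff_add_level[OF T d affine_on_cell_fs_partial, of n u v "\<xi>" "\<xi> h"] T
    by (simp add: fs_partial_Suc[abs_def] del: power_Suc)
qed

lemma fs_partial_dyadic_mono:
  assumes "T > 0" "n \<le> N"
  shows "fs_partial T u v \<xi> N (real m * T / 2 ^ Suc n) = fs_partial T u v \<xi> n (real m * T / 2 ^ Suc n)"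
  using assms(2)
proof (induction rule: dec_induct)
  case (step k)
  then show ?case
    using fs_fun_dyadic_eq_0[OF assms(1), of "Suc n" "Suc k" _ m] by (simp add: fs_partial_Suc del: power_Suc)
qed simp

text \<open>Explicit candidate for \<open>fs_coeff\<close>: the factor is the reciprocal of the one
  in \<open>dyadic_diff_fs_partial\<close>, and the value 0 off the system matches the convention in
  \<open>fs_coeff\<close>.\<close>

definition schauder_coeff :: "real \<Rightarrow> (real \<Rightarrow> real) \<Rightarrow> nat \<Rightarrow> nat \<Rightarrow> real" where
  "schauder_coeff T X h d = (if d < 2 ^ h then 2 powr (real h / 2) / sqrt T * dyadic_diff T X h d else 0)"

lemma schauder_scale: "T > 0 \<Longrightarrow> 2 powr (real h / 2) / sqrt T * (2 powr (- real h / 2) * sqrt T) = 1"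
  by (simp add: powr_minus field_simps)

lemma fs_partial_ends:
  assumes "T > 0"
  shows "fs_partial T u v \<xi> N 0 = u" "fs_partial T u v \<xi> N T = v"
proof -
  have "fs_fun T i j 0 = 0" "fs_fun T i j T = 0" for i j
    using fs_fun_dyadic_eq_0[OF assms, of 0 i j 0] fs_fun_dyadic_eq_0[OF assms, of 0 i j 1] by simp_all
  then show "fs_partial T u v \<xi> N 0 = u" "fs_partial T u v \<xi> N T = v"
    using assms by (simp_all add: fs_partial_def)
qed

text \<open>Even grid points belong to the coarser grid, where the new hats vanish. At an odd point,
  agreement at both neighbours and of the second difference forces agreement of the value.\<close>

lemma fs_partial_interpolates_step:
  assumes T: "T > 0"
    and f: "\<And>m. m \<le> 2 ^ h \<Longrightarrow> f (real m * T / 2 ^ h) = X (real m * T / 2 ^ h)"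
    and aff: "\<And>m. affine_on_cell T h m f"
    and m: "m \<le> 2 ^ Suc h"
  shows "f (real m * T / 2 ^ Suc h) + (\<Sum>j<2 ^ h. schauder_coeff T X h j * fs_fun T h j (real m * T / 2 ^ Suc h))
      = X (real m * T / 2 ^ Suc h)"
proof (cases "even m")
  case True
  then obtain d where "m = 2 * d" by (elim evenE)
  then show ?thesis
    using fs_fun_dyadic_eq_0[OF T order_refl, of h _ d] f[of d] m
    unfolding dyadic_double \<open>m = 2 * d\<close> by simp
next
  case False
  then obtain d where md: "m = 2 * d + 1" by (elim oddE)
  then have d: "d < 2 ^ h" using m by simp
  let ?f = "\<lambda>t. f t + (\<Sum>j<2 ^ h. schauder_coeff T X h j * fs_fun T h j t)"
  have 0: "?f (real d * T / 2 ^ h) = X (real d * T / 2 ^ h)"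
     "?f (real (d+1) * T / 2 ^ h) = X (real (d+1) * T / 2 ^ h)"
    using fs_fun_dyadic_eq_0[OF T order_refl, of h _ d] fs_fun_dyadic_eq_0[OF T order_refl, of h _ "d+1"]
      f[of d] f[of "d+1"] d
    by simp_all
  have "dyadic_diff T ?f h d = dyadic_diff T X h d"
  proof -
    have "dyadic_diff T ?f h d = schauder_coeff T X h d * (2 powr (- real h / 2) * sqrt T)"
      by (rule dyadic_diff_add_level[OF T d aff])
    also have "\<dots> = dyadic_diff T X h d
        * (2 powr (real h / 2) / sqrt T * (2 powr (- real h / 2) * sqrt T))"
      using d by (simp add: schauder_coeff_def)
    finally show ?thesis unfolding schauder_scale[OF T] by simp
  qed
  then have "?f (real (2*d+1) * T / 2 ^ Suc h) = X (real (2*d+1) * T / 2 ^ Suc h)"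
    unfolding dyadic_diff_def 0 by simp
  then show ?thesis unfolding md .
qed

lemma fs_partial_interpolates:
  assumes T: "T > 0" and "m \<le> 2 ^ Suc N"
  shows "fs_partial T (X 0) (X T) (schauder_coeff T X) N (real m * T / 2 ^ Suc N) = X (real m * T / 2 ^ Suc N)"
  using assms(2)
proof (induction N arbitrary: m)
  case 0
  show ?case
    unfolding fs_partial_0
  proof (rule fs_partial_interpolates_step[OF T])
    fix m :: nat assume "m \<le> 2 ^ 0"
    then have "m = 0 \<or> m = 1" by auto
    then show "(1 - real m * T / 2 ^ 0 / T) * X 0 + real m * T / 2 ^ 0 / T * X T = X (real m * T / 2 ^ 0)"
      using T by auto
  qed (use 0 affine_on_cell_linear in auto)
next
  case (Suc N)
  show ?case
    unfolding fs_partial_Suc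
    by (rule fs_partial_interpolates_step[OF T]) (use Suc T affine_on_cell_fs_partial in auto)
qed

text \<open>On a cell an affine function lies between its two end values; the sign of the slope
  decides which of them is the larger.\<close>

lemma affine_on_cell_near:
  assumes T: "T > 0" and "affine_on_cell T n m f" and t: "t \<in> fs_support T n m"
    and "\<bar>f (real m * T / 2 ^ n) - x\<bar> < e" "\<bar>f (real (m + 1) * T / 2 ^ n) - x\<bar> < e"
  shows "\<bar>f t - x\<bar> < e"
proof -
  obtain c d where *: "\<And>t. t \<in> fs_support T n m \<Longrightarrow> f t = c + d * t"
    using assms unfolding affine_on_cell_def by blast
  have "real m * T / 2 ^ n \<in> fs_support T n m" "real (m + 1) * T / 2 ^ n \<in> fs_support T n m"
    using T by (auto simp: fs_support_def field_simps)
  note f = *[OF this(1)] *[OF this(2)] *[OF t]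
  have b: "real m * T / 2 ^ n \<le> t" "t \<le> real (m + 1) * T / 2 ^ n"
    using t by (auto simp: fs_support_def add.commute)
  show ?thesis
  proof (cases "d \<ge> 0")
    case True
    from mult_left_mono[OF b(1) True] mult_left_mono[OF b(2) True] show ?thesis
      using assms(4,5) unfolding f by linarith
  next
    case False
    then have d: "d \<le> 0" by simp
    from mult_left_mono_neg[OF b(1) d] mult_left_mono_neg[OF b(2) d] show ?thesis
      using assms(4,5) unfolding f by linarith
  qed
qed

lemma dyadic_cell_exists:
  assumes T: "T > 0" and t: "t \<in> {0..T}"
  shows "\<exists>m<2 ^ n. t \<in> fs_support T n m"
\<comment> \<open>At the right end point the floor would give 2^n, one past the last cell.\<close>
proof (cases "t = T")
  case True
  then show ?thesis
    using T by (intro exI[of _ "2 ^ n - 1"]) (auto simp: fs_support_def of_nat_diff field_simps)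
next
  case False
  define m where "m = nat \<lfloor>2 ^ n * t / T\<rfloor>"
  have 0: "0 \<le> 2 ^ n * t / T" using T t by simp
  then have 1: "real m \<le> 2 ^ n * t / T" "2 ^ n * t / T < real m + 1"
    unfolding m_def by linarith+
  have "2 ^ n * t / T < 2 ^ n" using T t False by (simp add: field_simps)
  then have "real m < 2 ^ n" using 1 by linarith
  then have m: "m < 2 ^ n" by (metis of_nat_less_iff of_nat_numeral of_nat_power)
  have "t \<in> fs_support T n m"
    using 1(1) less_imp_le[OF 1(2)] T
    by (simp add: fs_support_def pos_le_divide_eq pos_divide_le_eq mult.commute)
  with m show ?thesis by blast
qed

text \<open>The partial sum agrees with the path at the ends of each cell of level N + 1 and is
  affine in between, so uniform continuity of the path at the scale of the mesh controls the
  error.\<close>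

lemma uniform_limit_schauder:
  assumes T: "T > 0" and X: "continuous_on {0..T} X"
  shows "uniform_limit {0..T} (fs_partial T (X 0) (X T) (schauder_coeff T X)) X sequentially"
proof (rule uniform_limitI)
  fix e :: real assume "e > 0"
  have "uniformly_continuous_on {0..T} X"
    using X by (intro compact_uniformly_continuous) auto
  then obtain \<delta> where \<delta>: "\<delta> > 0" "\<And>s t. s \<in> {0..T} \<Longrightarrow> t \<in> {0..T} \<Longrightarrow> \<bar>s - t\<bar> < \<delta> \<Longrightarrow> \<bar>X s - X t\<bar> < e"
    using \<open>e > 0\<close> unfolding uniformly_continuous_on_def dist_real_def by metis
  have "(\<lambda>N. T / 2 ^ Suc N) \<longlonglongrightarrow> 0"
    by (rule LIMSEQ_divide_realpow_zero[THEN LIMSEQ_Suc]) auto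
  then have "\<forall>\<^sub>F N in sequentially. T / 2 ^ Suc N < \<delta>"
    using \<delta>(1) by (simp add: order_tendstoD(2))
  then show "\<forall>\<^sub>F N in sequentially. \<forall>t\<in>{0..T}. dist (fs_partial T (X 0) (X T) (schauder_coeff T X) N t) (X t) < e"
  proof eventually_elim
    case (elim N)
    show ?case
    proof
      fix t assume t: "t \<in> {0..T}"
      obtain m where m: "m < 2 ^ Suc N" "t \<in> fs_support T (Suc N) m"
        using dyadic_cell_exists[OF T t] by blast
      have gap: "real (m + 1) * T / 2 ^ Suc N - real m * T / 2 ^ Suc N = T / 2 ^ Suc N"
        by (simp add: diff_divide_distrib[symmetric] algebra_simps)
      have b: "real m * T / 2 ^ Suc N \<le> t" "t \<le> real (m + 1) * T / 2 ^ Suc N"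
        using m(2) by (auto simp: fs_support_def add.commute)
      have near: "\<bar>X (real a * T / 2 ^ Suc N) - X t\<bar> < e" if "a = m \<or> a = m + 1" for a
        using that b gap elim m(1) by (intro \<delta>(2) dyadic_point_in[OF T] t) (auto simp del: power_Suc)
      have "\<bar>fs_partial T (X 0) (X T) (schauder_coeff T X) N t - X t\<bar> < e"
        using m(1) fs_partial_interpolates[OF T, of m N X] fs_partial_interpolates[OF T, of "m + 1" N X]
          near[of m] near[of "m + 1"]
        by (intro affine_on_cell_near[OF T affine_on_cell_fs_partial[OF T lessI] m(2)])
          (simp_all only: less_imp_le Suc_leI Suc_eq_plus1[symmetric] simp_thms)
      then show "dist (fs_partial T (X 0) (X T) (schauder_coeff T X) N t) (X t) < e"
        by (simp add: dist_real_def)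
    qed
  qed
qed

text \<open>For uniqueness: on a fixed grid the partial sums of any admissible expansion are
  eventually constant in \<open>N\<close>, so a finite partial sum already equals the path there,
  and second differences read off its coefficients.\<close>

lemma fs_coeff_eq:
  assumes T: "T > 0" and X: "continuous_on {0..T} X"
  shows "fs_coeff T X = schauder_coeff T X"
  unfolding fs_coeff_def
proof (rule the_equality)
  show "(\<forall>i j. 2 ^ i \<le> j \<longrightarrow> schauder_coeff T X i j = 0) \<and>
    uniform_limit {0..T} (fs_partial T (X 0) (X T) (schauder_coeff T X)) X sequentially"
    using uniform_limit_schauder[OF T X] by (auto simp: schauder_coeff_def)
next
  fix \<xi> :: "nat \<Rightarrow> nat \<Rightarrow> real"
  assume *: "(\<forall>i j. 2 ^ i \<le> j \<longrightarrow> \<xi> i j = 0) \<and> uniform_limit {0..T} (fs_partial T (X 0) (X T) \<xi>) X sequentially"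
  have eq: "fs_partial T (X 0) (X T) \<xi> h (real m * T / 2 ^ Suc h) = X (real m * T / 2 ^ Suc h)"
    if m: "m \<le> 2 ^ Suc h" for m h
  proof -
    have "real m * T / 2 ^ Suc h \<in> {0..T}" using dyadic_point_in[OF T m] .
    then have "(\<lambda>N. fs_partial T (X 0) (X T) \<xi> N (real m * T / 2 ^ Suc h)) \<longlonglongrightarrow> X (real m * T / 2 ^ Suc h)"
      by (rule tendsto_uniform_limitI[OF conjunct2[OF *]])
    moreover have "\<forall>\<^sub>F N in sequentially. fs_partial T (X 0) (X T) \<xi> N (real m * T / 2 ^ Suc h)
        = fs_partial T (X 0) (X T) \<xi> h (real m * T / 2 ^ Suc h)"
      using eventually_ge_at_top[of h]
      by eventually_elim (rule fs_partial_dyadic_mono[OF T])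
    then have "(\<lambda>N. fs_partial T (X 0) (X T) \<xi> N (real m * T / 2 ^ Suc h)) \<longlonglongrightarrow>
        fs_partial T (X 0) (X T) \<xi> h (real m * T / 2 ^ Suc h)"
      by (rule tendsto_eventually)
    ultimately show ?thesis by (metis LIMSEQ_unique)
  qed
  show "\<xi> = schauder_coeff T X"
  proof (intro ext)
    fix h d
    show "\<xi> h d = schauder_coeff T X h d"
    proof (cases "d < 2 ^ h")
      case True
      have "dyadic_diff T X h d = \<xi> h d * (2 powr (- real h / 2) * sqrt T)"
        unfolding dyadic_diff_fs_partial[OF T True, of "X 0" "X T" \<xi>, symmetric]
        by (rule dyadic_diff_cong[OF _ True], rule eq[symmetric])
      then have "schauder_coeff T X h d
          = \<xi> h d * (2 powr (real h / 2) / sqrt T * (2 powr (- real h / 2) * sqrt T))"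
        using True by (simp add: schauder_coeff_def)
      then show ?thesis unfolding schauder_scale[OF T] by simp
    qed (use * in \<open>auto simp: schauder_coeff_def\<close>)
  qed
qed

section \<open>Sums and differences of independent normal variables\<close>

context prob_space
begin

text \<open>One product formula over all of \<open>I\<close> suffices, since taking
  \<open>A i\<close> to be the whole space removes an index. The empty family is treated apart
  because \<open>indep_vars_finite\<close> concerns nonempty ones.\<close>

lemma indep_vars_finiteI:
  assumes I: "finite I" and rv: "\<And>i. i \<in> I \<Longrightarrow> random_variable (M' i) (X i)"
    and prod: "\<And>A. (\<And>i. i \<in> I \<Longrightarrow> A i \<in> sets (M' i)) \<Longrightarrow>
      prob {\<omega>\<in>space M. \<forall>i\<in>I. X i \<omega> \<in> A i} = (\<Prod>i\<in>I. prob {\<omega>\<in>space M. X i \<omega> \<in> A i})"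
  shows "indep_vars M' X I"
proof (cases "I = {}")
  case True
  then show ?thesis by (auto simp: indep_vars_def indep_sets_def)
next
  case False
  have *: "prob (\<Inter>j\<in>I. X j -` A j \<inter> space M) = (\<Prod>j\<in>I. prob (X j -` A j \<inter> space M))"
    if "A \<in> (\<Pi> i\<in>I. sets (M' i))" for A
  proof -
    have "(\<Inter>j\<in>I. X j -` A j \<inter> space M) = {\<omega>\<in>space M. \<forall>i\<in>I. X i \<omega> \<in> A i}"
      using False by auto
    moreover have "X j -` A j \<inter> space M = {\<omega>\<in>space M. X j \<omega> \<in> A j}" for j by auto
    ultimately show ?thesis using prod[of A] that by (simp add: Pi_iff)
  qed
  show ?thesis
    using indep_vars_finite[OF False I, where E = "\<lambda>i. sets (M' i)" and M' = M' and X = X] rv *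
    by (simp add: sets.sigma_sets_eq sets.Int_stable sets.space_closed)
qed

lemma indep_vars_prob:
  assumes X: "indep_vars M' X I" and J: "finite J" "J \<subseteq> I" and A: "\<And>i. i \<in> J \<Longrightarrow> A i \<in> sets (M' i)"
  shows "prob {\<omega>\<in>space M. \<forall>i\<in>J. X i \<omega> \<in> A i} = (\<Prod>i\<in>J. prob {\<omega>\<in>space M. X i \<omega> \<in> A i})"
proof (cases "J = {}")
  case True
  then show ?thesis by (simp add: prob_space)
next
  case False
  have "{\<omega>\<in>space M. \<forall>i\<in>J. X i \<omega> \<in> A i} = (\<Inter>j\<in>J. X j -` A j \<inter> space M)"
    using False by auto
  moreover have "X j -` A j \<inter> space M = {\<omega>\<in>space M. X j \<omega> \<in> A j}" for j by auto
  ultimately show ?thesis using indep_varsD[OF X False J A] by simp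
qed

lemma indep_vars_rv: "indep_vars M' X I \<Longrightarrow> i \<in> I \<Longrightarrow> random_variable (M' i) (X i)"
  by (auto simp: indep_vars_def)

lemma indep_vars_reindex:
  assumes X: "indep_vars M' X J" and I: "finite I" and f: "inj_on f I" "f ` I \<subseteq> J"
  shows "indep_vars (\<lambda>i. M' (f i)) (\<lambda>i. X (f i)) I"
proof (rule indep_vars_finiteI[OF I])
  fix A assume A: "\<And>i. i \<in> I \<Longrightarrow> A i \<in> sets (M' (f i))"
  let ?B = "\<lambda>j. A (inv_into I f j)"
  have B: "?B (f i) = A i" if "i \<in> I" for i using f that by simp
  have "prob {\<omega>\<in>space M. \<forall>j\<in>f ` I. X j \<omega> \<in> ?B j} = (\<Prod>j\<in>f ` I. prob {\<omega>\<in>space M. X j \<omega> \<in> ?B j})"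
    using f I A by (intro indep_vars_prob[OF X]) (auto simp: B)
  also have "\<dots> = (\<Prod>i\<in>I. prob {\<omega>\<in>space M. X (f i) \<omega> \<in> A i})"
    using f by (subst prod.reindex) (auto simp: B)
  also have "{\<omega>\<in>space M. \<forall>j\<in>f ` I. X j \<omega> \<in> ?B j} = {\<omega>\<in>space M. \<forall>i\<in>I. X (f i) \<omega> \<in> A i}"
    by (auto simp: B)
  finally show "prob {\<omega>\<in>space M. \<forall>i\<in>I. X (f i) \<omega> \<in> A i} = (\<Prod>i\<in>I. prob {\<omega>\<in>space M. X (f i) \<omega> \<in> A i})" .
next
  show "random_variable (M' (f i)) (X (f i))" if "i \<in> I" for i
    using f(2) that by (intro indep_vars_rv[OF X]) auto
qed

lemma indep_vars_cong_space:
  assumes X: "indep_vars M' X I" and I: "finite I"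
    and eq: "\<And>i \<omega>. i \<in> I \<Longrightarrow> \<omega> \<in> space M \<Longrightarrow> X i \<omega> = Y i \<omega>"
  shows "indep_vars M' Y I"
proof (rule indep_vars_finiteI[OF I])
  show "random_variable (M' i) (Y i)" if "i \<in> I" for i
    using indep_vars_rv[OF X that] measurable_cong[of M "X i" "Y i" "M' i", OF eq[OF that]] by simp
  fix A assume A: "\<And>i. i \<in> I \<Longrightarrow> A i \<in> sets (M' i)"
  have "{\<omega>\<in>space M. \<forall>i\<in>I. Y i \<omega> \<in> A i} = {\<omega>\<in>space M. \<forall>i\<in>I. X i \<omega> \<in> A i}"
    using eq by auto
  moreover have "{\<omega>\<in>space M. Y i \<omega> \<in> A i} = {\<omega>\<in>space M. X i \<omega> \<in> A i}" if "i \<in> I" for i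
    using eq that by auto
  ultimately show "prob {\<omega>\<in>space M. \<forall>i\<in>I. Y i \<omega> \<in> A i} = (\<Prod>i\<in>I. prob {\<omega>\<in>space M. Y i \<omega> \<in> A i})"
    using indep_vars_prob[OF X I order_refl A] by simp
qed

text \<open>Serves to carry independence from the Wiener measure to the bridge law, which is its
  image under a path map.\<close>

lemma indep_vars_distr:
  assumes I: "finite I" and \<Phi>: "random_variable N \<Phi>"
    and X: "\<And>i. i \<in> I \<Longrightarrow> X i \<in> measurable N (M' i)"
    and ind: "indep_vars M' (\<lambda>i \<omega>. X i (\<Phi> \<omega>)) I"
  shows "prob_space.indep_vars (distr M N \<Phi>) M' X I"
proof -
  interpret D: prob_space "distr M N \<Phi>" using \<Phi> by (rule prob_space_distr)
  have prob_eq: "D.prob {x\<in>space N. P x} = prob {\<omega>\<in>space M. P (\<Phi> \<omega>)}" if "{x\<in>space N. P x} \<in> sets N" for P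
  proof -
    have "\<Phi> -` {x\<in>space N. P x} \<inter> space M = {\<omega>\<in>space M. P (\<Phi> \<omega>)}"
      using measurable_space[OF \<Phi>] by auto
    then show ?thesis using measure_distr[OF \<Phi> that] by simp
  qed
  show ?thesis
  proof (rule D.indep_vars_finiteI[OF I])
    fix A assume A: "\<And>i. i \<in> I \<Longrightarrow> A i \<in> sets (M' i)"
    have [measurable]: "{x\<in>space N. X i x \<in> A i} \<in> sets N" if "i \<in> I" for i
    proof -
      have "{x\<in>space N. X i x \<in> A i} = X i -` A i \<inter> space N" by auto
      then show ?thesis using measurable_sets[OF X A, OF that that] by simp
    qed
    have "{x\<in>space N. \<forall>i\<in>I. X i x \<in> A i} \<in> sets N"
      using I by (rule sets.sets_Collect_finite_All[rotated]) simp
    then show "D.prob {x\<in>space (distr M N \<Phi>). \<forall>i\<in>I. X i x \<in> A i} = (\<Prod>i\<in>I. D.prob {x\<in>space (distr M N \<Phi>). X i x \<in> A i})"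
      using indep_vars_prob[OF ind I order_refl A] by (simp add: prob_eq)
  qed (use X in auto)
qed

lemma indep_var_prob:
  assumes "indep_var S X T Y" "A \<in> sets S" "B \<in> sets T"
  shows "prob {\<omega>\<in>space M. X \<omega> \<in> A \<and> Y \<omega> \<in> B} = prob {\<omega>\<in>space M. X \<omega> \<in> A} * prob {\<omega>\<in>space M. Y \<omega> \<in> B}"
proof -
  have "{\<omega>\<in>space M. X \<omega> \<in> A \<and> Y \<omega> \<in> B} = (\<lambda>x. (X x, Y x)) -` (A \<times> B) \<inter> space M"
    "{\<omega>\<in>space M. X \<omega> \<in> A} = X -` A \<inter> space M" "{\<omega>\<in>space M. Y \<omega> \<in> B} = Y -` B \<inter> space M"
    by auto
  then show ?thesis using indep_varD[OF assms] by simp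
qed

end

section \<open>Rotation of a pair of independent Gaussian variables\<close>

text \<open>With x = (w + z)/2 and y = (w - z)/2 one has x^2 + y^2 = (w^2 + z^2)/2, so the exponent
  splits with doubled variance. The division by 2 is the Jacobian of the substitution.\<close>

lemma normal_density_rotate:
  assumes "\<sigma> > 0"
  shows "normal_density 0 \<sigma> ((w + z) / 2) * normal_density 0 \<sigma> ((w - z) / 2) / 2
    = normal_density 0 (sqrt (\<sigma>\<^sup>2 + \<sigma>\<^sup>2)) w * normal_density 0 (sqrt (\<sigma>\<^sup>2 + \<sigma>\<^sup>2)) z"
proof -
  have s: "(sqrt (\<sigma>\<^sup>2 + \<sigma>\<^sup>2))\<^sup>2 = 2 * \<sigma>\<^sup>2" by simp
  have e: "- ((w + z) / 2)\<^sup>2 / (2 * \<sigma>\<^sup>2) + - ((w - z) / 2)\<^sup>2 / (2 * \<sigma>\<^sup>2)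
      = - w\<^sup>2 / (2 * (2 * \<sigma>\<^sup>2)) + - z\<^sup>2 / (2 * (2 * \<sigma>\<^sup>2))"
    using assms by (simp add: field_simps power2_eq_square)
  have q: "1 / sqrt (2 * pi * \<sigma>\<^sup>2) * (1 / sqrt (2 * pi * \<sigma>\<^sup>2)) / 2
     = 1 / sqrt (2 * pi * (2 * \<sigma>\<^sup>2)) * (1 / sqrt (2 * pi * (2 * \<sigma>\<^sup>2)))"
    using assms by simp
  have "normal_density 0 \<sigma> ((w + z) / 2) * normal_density 0 \<sigma> ((w - z) / 2) / 2
    = (1 / sqrt (2 * pi * \<sigma>\<^sup>2) * (1 / sqrt (2 * pi * \<sigma>\<^sup>2)) / 2)
       * exp (- ((w + z) / 2)\<^sup>2 / (2 * \<sigma>\<^sup>2) + - ((w - z) / 2)\<^sup>2 / (2 * \<sigma>\<^sup>2))"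
    unfolding normal_density_def exp_add by simp
  also have "\<dots> = normal_density 0 (sqrt (\<sigma>\<^sup>2 + \<sigma>\<^sup>2)) w * normal_density 0 (sqrt (\<sigma>\<^sup>2 + \<sigma>\<^sup>2)) z"
    unfolding e q exp_add normal_density_def s by simp
  finally show ?thesis .
qed

text \<open>The planar substitution w = x + y, z = x - y is made one coordinate at a time: a shift
  in the integral over x, and, after exchanging the order again, a reflected scaling in y.\<close>

lemma nn_integral_normal_rotate:
  fixes A B :: "real set"
  assumes [simp]: "\<sigma> > 0" and [measurable]: "A \<in> sets borel" "B \<in> sets borel"
  defines "n \<equiv> normal_density 0 \<sigma>" and "n' \<equiv> normal_density 0 (sqrt (\<sigma>\<^sup>2 + \<sigma>\<^sup>2))"
  shows "(\<integral>\<^sup>+x. \<integral>\<^sup>+y. indicator A (x + y) * indicator B (x - y) * ennreal (n x * n y) \<partial>lborel \<partial>lborel)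
    = (\<integral>\<^sup>+w. indicator A w * ennreal (n' w) \<partial>lborel) * (\<integral>\<^sup>+z. indicator B z * ennreal (n' z) \<partial>lborel)"
proof -
  have [measurable]: "n \<in> borel_measurable borel" "n' \<in> borel_measurable borel"
    by (simp_all add: n_def n'_def)
  have nn: "n x \<ge> 0" "n' x \<ge> 0" for x by (simp_all add: n_def n'_def)
  have "(\<integral>\<^sup>+x. \<integral>\<^sup>+y. indicator A (x + y) * indicator B (x - y) * ennreal (n x * n y) \<partial>lborel \<partial>lborel)
    = (\<integral>\<^sup>+y. \<integral>\<^sup>+x. indicator A (x + y) * indicator B (x - y) * ennreal (n x * n y) \<partial>lborel \<partial>lborel)"
    by (rule lborel_pair.Fubini') measurable
  also have "\<dots> = (\<integral>\<^sup>+y. \<integral>\<^sup>+w. indicator A w * indicator B (w - 2 * y) * ennreal (n (w - y) * n y) \<partial>lborel \<partial>lborel)"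
  proof (rule nn_integral_cong)
    fix y :: real
    show "(\<integral>\<^sup>+x. indicator A (x + y) * indicator B (x - y) * ennreal (n x * n y) \<partial>lborel)
      = (\<integral>\<^sup>+w. indicator A w * indicator B (w - 2 * y) * ennreal (n (w - y) * n y) \<partial>lborel)"
      using nn_integral_real_affine[of "\<lambda>x. indicator A (x + y) * indicator B (x - y) * ennreal (n x * n y)" 1 "- y"]
      by (simp add: algebra_simps)
  qed
  also have "\<dots> = (\<integral>\<^sup>+w. \<integral>\<^sup>+y. indicator A w * indicator B (w - 2 * y) * ennreal (n (w - y) * n y) \<partial>lborel \<partial>lborel)"
    by (rule lborel_pair.Fubini') measurable
  also have "\<dots> = (\<integral>\<^sup>+w. indicator A w * ennreal (n' w) * (\<integral>\<^sup>+z. indicator B z * ennreal (n' z) \<partial>lborel) \<partial>lborel)"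
  proof (rule nn_integral_cong)
    fix w :: real
    have "(\<integral>\<^sup>+y. indicator A w * indicator B (w - 2 * y) * ennreal (n (w - y) * n y) \<partial>lborel)
      = (\<integral>\<^sup>+z. indicator A w * (indicator B z * ennreal (n ((w + z) / 2) * n ((w - z) / 2) / 2)) \<partial>lborel)"
    proof -
      \<comment> \<open>The substitution y = (w - z)/2 for fixed \<open>w\<close>, with Jacobian
        1/2.\<close>
      have "(\<integral>\<^sup>+y. indicator A w * indicator B (w - 2 * y) * ennreal (n (w - y) * n y) \<partial>lborel)
        = ennreal (1 / 2) * (\<integral>\<^sup>+z. indicator A w * indicator B (w - 2 * (w / 2 + (- 1 / 2) * z))
            * ennreal (n (w - (w / 2 + (- 1 / 2) * z)) * n (w / 2 + (- 1 / 2) * z)) \<partial>lborel)"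
        using nn_integral_real_affine[of "\<lambda>y. indicator A w * indicator B (w - 2 * y) * ennreal (n (w - y) * n y)" "- 1 / 2" "w / 2"]
        by simp
      also have "\<dots> = (\<integral>\<^sup>+z. ennreal (1 / 2) * (indicator A w * indicator B (w - 2 * (w / 2 + (- 1 / 2) * z))
            * ennreal (n (w - (w / 2 + (- 1 / 2) * z)) * n (w / 2 + (- 1 / 2) * z))) \<partial>lborel)"
        by (rule nn_integral_cmult[symmetric]) measurable
      also have "\<dots> = (\<integral>\<^sup>+z. indicator A w * (indicator B z * ennreal (n ((w + z) / 2) * n ((w - z) / 2) / 2)) \<partial>lborel)"
      proof (rule nn_integral_cong)
        fix z :: real
        have "w - 2 * (w / 2 + (- 1 / 2) * z) = z" "w - (w / 2 + (- 1 / 2) * z) = (w + z) / 2"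
          "w / 2 + (- 1 / 2) * z = (w - z) / 2" by (simp_all add: field_simps)
        moreover have "ennreal (n ((w + z) / 2) * n ((w - z) / 2) / 2)
            = ennreal (1 / 2) * ennreal (n ((w + z) / 2) * n ((w - z) / 2))"
          using nn by (subst ennreal_mult[symmetric]) (simp_all add: mult_ac)
        ultimately show "ennreal (1 / 2) * (indicator A w * indicator B (w - 2 * (w / 2 + (- 1 / 2) * z))
            * ennreal (n (w - (w / 2 + (- 1 / 2) * z)) * n (w / 2 + (- 1 / 2) * z)))
            = indicator A w * (indicator B z * ennreal (n ((w + z) / 2) * n ((w - z) / 2) / 2))"
          by (simp only: mult_ac)
      qed
      finally show ?thesis .
    qed
    also have "\<dots> = (\<integral>\<^sup>+z. indicator A w * ennreal (n' w) * (indicator B z * ennreal (n' z)) \<partial>lborel)"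
      unfolding n_def normal_density_rotate[OF assms(1)] n'_def
      by (intro nn_integral_cong) (simp add: ennreal_mult' mult_ac)
    also have "\<dots> = indicator A w * ennreal (n' w) * (\<integral>\<^sup>+z. indicator B z * ennreal (n' z) \<partial>lborel)"
      by (rule nn_integral_cmult) simp
    finally show "(\<integral>\<^sup>+y. indicator A w * indicator B (w - 2 * y) * ennreal (n (w - y) * n y) \<partial>lborel)
      = indicator A w * ennreal (n' w) * (\<integral>\<^sup>+z. indicator B z * ennreal (n' z) \<partial>lborel)" .
  qed
  also have "\<dots> = (\<integral>\<^sup>+w. indicator A w * ennreal (n' w) \<partial>lborel) * (\<integral>\<^sup>+z. indicator B z * ennreal (n' z) \<partial>lborel)"
    by (rule nn_integral_multc) simp
  finally show ?thesis .
qed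

lemma (in prob_space) emeasure_distributed:
  assumes "distributed M lborel X (\<lambda>x. ennreal (f x))" "A \<in> sets borel"
  shows "emeasure M {\<omega>\<in>space M. X \<omega> \<in> A} = (\<integral>\<^sup>+x. indicator A x * ennreal (f x) \<partial>lborel)"
proof -
  have "emeasure M (X -` A \<inter> space M) = (\<integral>\<^sup>+x. ennreal (f x) * indicator A x \<partial>lborel)"
    using assms by (intro distributed_emeasure) auto
  then show ?thesis by (simp add: vimage_def Int_def conj_commute mult.commute)
qed

text \<open>Rotation invariance of the Gaussian product law, for which the common \<sigma> is
  essential. The two factors produced by \<open>nn_integral_normal_rotate\<close> are the laws of
  the sum and of the difference, both normal with variance 2 \<sigma>^2.\<close>

lemma (in prob_space) prob_normal_sum_diff:
  assumes ind: "indep_var borel X borel Y" and [simp]: "\<sigma> > 0"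
    and X: "distributed M lborel X (normal_density 0 \<sigma>)"
    and Y: "distributed M lborel Y (normal_density 0 \<sigma>)"
    and [measurable]: "A \<in> sets borel" "B \<in> sets borel"
  shows "prob {\<omega>\<in>space M. X \<omega> + Y \<omega> \<in> A \<and> X \<omega> - Y \<omega> \<in> B}
    = prob {\<omega>\<in>space M. X \<omega> + Y \<omega> \<in> A} * prob {\<omega>\<in>space M. X \<omega> - Y \<omega> \<in> B}"
proof -
  have [measurable]: "random_variable borel X" "random_variable borel Y"
    using ind by (auto dest: indep_var_rv1 indep_var_rv2)
  have "indep_var lborel X lborel Y"
    using ind by (simp add: indep_var_eq)
  then have joint: "distributed M (lborel \<Otimes>\<^sub>M lborel) (\<lambda>\<omega>. (X \<omega>, Y \<omega>)) (\<lambda>(x, y). ennreal (normal_density 0 \<sigma> x) * ennreal (normal_density 0 \<sigma> y))"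
    by (intro distributed_joint_indep X Y) (auto intro: lborel.sigma_finite_measure_axioms)
  let ?S = "{p. fst p + snd p \<in> A \<and> fst p - snd p \<in> B} :: (real \<times> real) set"
  have S: "?S \<in> sets (lborel \<Otimes>\<^sub>M lborel)"
  proof -
    have "{p\<in>space (lborel \<Otimes>\<^sub>M lborel). fst p + snd p \<in> A \<and> fst p - snd p \<in> B} \<in> sets (lborel \<Otimes>\<^sub>M lborel)"
      by measurable
    then show ?thesis by (simp add: space_pair_measure)
  qed
  have "emeasure M ((\<lambda>\<omega>. (X \<omega>, Y \<omega>)) -` ?S \<inter> space M)
    = (\<integral>\<^sup>+p. (case p of (x, y) \<Rightarrow> ennreal (normal_density 0 \<sigma> x) * ennreal (normal_density 0 \<sigma> y)) * indicator ?S p \<partial>(lborel \<Otimes>\<^sub>M lborel))"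
    by (rule distributed_emeasure[OF joint S])
  also have "\<dots> = (\<integral>\<^sup>+x. \<integral>\<^sup>+y. indicator A (x + y) * indicator B (x - y) * ennreal (normal_density 0 \<sigma> x * normal_density 0 \<sigma> y) \<partial>lborel \<partial>lborel)"
    using S by (subst lborel.nn_integral_fst[symmetric])
      (auto simp: ennreal_mult' intro!: nn_integral_cong split: split_indicator)
  also have "\<dots> = emeasure M {\<omega>\<in>space M. X \<omega> + Y \<omega> \<in> A} * emeasure M {\<omega>\<in>space M. X \<omega> - Y \<omega> \<in> B}"
  proof -
    have "distributed M lborel (\<lambda>x. X x + Y x) (normal_density (0 + 0) (sqrt (\<sigma>\<^sup>2 + \<sigma>\<^sup>2)))"
      "distributed M lborel (\<lambda>x. X x - Y x) (normal_density (0 - 0) (sqrt (\<sigma>\<^sup>2 + \<sigma>\<^sup>2)))"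
      by (intro add_indep_normal diff_indep_normal ind X Y; simp)+
    then show ?thesis
      unfolding nn_integral_normal_rotate[OF assms(2) assms(5,6)]
      by (simp only: emeasure_distributed assms(5,6) add_0 diff_zero)
  qed
  finally have "emeasure M {\<omega>\<in>space M. X \<omega> + Y \<omega> \<in> A \<and> X \<omega> - Y \<omega> \<in> B}
    = emeasure M {\<omega>\<in>space M. X \<omega> + Y \<omega> \<in> A} * emeasure M {\<omega>\<in>space M. X \<omega> - Y \<omega> \<in> B}"
    by (simp add: vimage_def Int_def conj_commute)
  then show ?thesis by (simp add: emeasure_eq_measure ennreal_mult'[symmetric])
qed

text \<open>The pair at \<open>a\<close> and \<open>b\<close> is independent of the remaining block,
  which keeps its product formula; within the pair, rotation invariance applies.\<close>

lemma (in prob_space) indep_vars_sum_diff: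
  fixes Z :: "'i \<Rightarrow> 'a \<Rightarrow> real"
  assumes Z: "indep_vars (\<lambda>_. borel) Z I" and I: "finite I" "a \<in> I" "b \<in> I" "a \<noteq> b"
    and \<sigma>: "\<sigma> > 0"
    and a: "distributed M lborel (Z a) (normal_density 0 \<sigma>)"
    and b: "distributed M lborel (Z b) (normal_density 0 \<sigma>)"
  shows "indep_vars (\<lambda>_. borel) (Z(a := \<lambda>\<omega>. Z a \<omega> + Z b \<omega>, b := \<lambda>\<omega>. Z a \<omega> - Z b \<omega>)) I"
    (is "indep_vars _ ?Z I")
proof (rule indep_vars_finiteI[OF I(1)])
  have rv: "random_variable borel (Z i)" if "i \<in> I" for i
    using indep_vars_rv[OF Z that] by simp
  note [measurable] = rv[OF I(2)] rv[OF I(3)]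
  show "random_variable borel (?Z i)" if "i \<in> I" for i
    using rv[OF that] by auto
  fix A :: "'i \<Rightarrow> real set" assume "\<And>i. i \<in> I \<Longrightarrow> A i \<in> sets borel"
  note A = this and [measurable] = this[OF I(2)] this[OF I(3)]
  define J where "J = I - {a, b}"
  have J: "finite J" "J \<subseteq> I" "{a, b} \<inter> J = {}" "{a, b} \<subseteq> I" "I = insert a (insert b J)"
    using I by (auto simp: J_def)
  let ?R = "\<lambda>K \<omega>. \<lambda>i\<in>K. Z i \<omega>"
  let ?S = "{f\<in>space (PiM {a, b} (\<lambda>_. borel)). f a + f b \<in> A a \<and> f a - f b \<in> A b}"
  let ?T = "{f\<in>space (PiM J (\<lambda>_. borel)). \<forall>i\<in>J. f i \<in> A i}"
  have "?S \<in> sets (PiM {a, b} (\<lambda>_. borel))" by measurable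
  moreover have "?T \<in> sets (PiM J (\<lambda>_. borel))"
  proof -
    have "?T = PiE J A" using A J(2) by (auto simp: space_PiM PiE_def)
    then show ?thesis using A J(1,2) by (auto intro!: sets_PiM_I_finite)
  qed
  ultimately have "prob {\<omega>\<in>space M. ?R {a, b} \<omega> \<in> ?S \<and> ?R J \<omega> \<in> ?T}
      = prob {\<omega>\<in>space M. ?R {a, b} \<omega> \<in> ?S} * prob {\<omega>\<in>space M. ?R J \<omega> \<in> ?T}"
    by (intro indep_var_prob[OF indep_var_restrict[OF Z J(3,4,2)]])
  also have "{\<omega>\<in>space M. ?R {a, b} \<omega> \<in> ?S \<and> ?R J \<omega> \<in> ?T} = {\<omega>\<in>space M. \<forall>i\<in>I. ?Z i \<omega> \<in> A i}"
    using J(3) I(4) unfolding J(5) by (auto simp: space_PiM)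
  also have "{\<omega>\<in>space M. ?R {a, b} \<omega> \<in> ?S} = {\<omega>\<in>space M. Z a \<omega> + Z b \<omega> \<in> A a \<and> Z a \<omega> - Z b \<omega> \<in> A b}"
    by (auto simp: space_PiM)
  also have "{\<omega>\<in>space M. ?R J \<omega> \<in> ?T} = {\<omega>\<in>space M. \<forall>i\<in>J. Z i \<omega> \<in> A i}"
    by (auto simp: space_PiM)
  also have "prob \<dots> = (\<Prod>i\<in>J. prob {\<omega>\<in>space M. Z i \<omega> \<in> A i})"
    using J A by (intro indep_vars_prob[OF Z]) auto
  also have "prob {\<omega>\<in>space M. Z a \<omega> + Z b \<omega> \<in> A a \<and> Z a \<omega> - Z b \<omega> \<in> A b}
    = prob {\<omega>\<in>space M. Z a \<omega> + Z b \<omega> \<in> A a} * prob {\<omega>\<in>space M. Z a \<omega> - Z b \<omega> \<in> A b}"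
  proof (rule prob_normal_sum_diff[OF _ \<sigma> a b])
    have "indep_var borel ((\<lambda>f. f a) \<circ> ?R {a}) borel ((\<lambda>f. f b) \<circ> ?R {b})"
      using I by (intro indep_var_compose[OF indep_var_restrict[OF Z]] measurable_component_singleton) auto
    then show "indep_var borel (Z a) borel (Z b)" by (simp add: comp_def)
  qed measurable
  also have "\<dots> * (\<Prod>i\<in>J. prob {\<omega>\<in>space M. Z i \<omega> \<in> A i}) = (\<Prod>i\<in>I. prob {\<omega>\<in>space M. ?Z i \<omega> \<in> A i})"
  proof -
    have "(\<Prod>i\<in>J. prob {\<omega>\<in>space M. Z i \<omega> \<in> A i}) = (\<Prod>i\<in>J. prob {\<omega>\<in>space M. ?Z i \<omega> \<in> A i})"
      using J(3) by (intro prod.cong) auto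
    then show ?thesis
      using J(1,3) I(4) unfolding J(5) by simp
  qed
  finally show "prob {\<omega>\<in>space M. \<forall>i\<in>I. ?Z i \<omega> \<in> A i} = (\<Prod>i\<in>I. prob {\<omega>\<in>space M. ?Z i \<omega> \<in> A i})" .
qed

text \<open>Pairs are exchanged one at a time. They are disjoint, so the pair treated next still
  carries the original variables with their common normal law.\<close>

lemma (in prob_space) indep_vars_sum_diff_pairs:
  fixes Z Z' :: "'i \<Rightarrow> 'a \<Rightarrow> real"
  assumes Z: "indep_vars (\<lambda>_. borel) Z I" and I: "finite I" and "finite K"
    and "inj_on a K" "inj_on b K" "a ` K \<inter> b ` K = {}" "a ` K \<subseteq> I" "b ` K \<subseteq> I"
    and \<sigma>: "\<sigma> > 0"
    and "\<And>k. k \<in> K \<Longrightarrow> distributed M lborel (Z (a k)) (normal_density 0 \<sigma>)"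
    and "\<And>k. k \<in> K \<Longrightarrow> distributed M lborel (Z (b k)) (normal_density 0 \<sigma>)"
    and "\<And>k. k \<in> K \<Longrightarrow> Z' (a k) = (\<lambda>\<omega>. Z (a k) \<omega> + Z (b k) \<omega>)"
    and "\<And>k. k \<in> K \<Longrightarrow> Z' (b k) = (\<lambda>\<omega>. Z (a k) \<omega> - Z (b k) \<omega>)"
    and "\<And>i. i \<in> I \<Longrightarrow> i \<notin> a ` K \<Longrightarrow> i \<notin> b ` K \<Longrightarrow> Z' i = Z i"
  shows "indep_vars (\<lambda>_. borel) Z' I"
  using assms(3-)
proof (induction K arbitrary: Z' rule: finite_induct)
  case empty
  then show ?case using Z by (subst indep_vars_cong[where Y = Z]) auto
next
  case (insert k K)
  \<comment> \<open>\<open>Z'\<close> with the exchange at \<open>k\<close> undone: the induction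
    hypothesis covers it, and one further exchange gives \<open>Z'\<close>.\<close>
  let ?Y = "Z'(a k := Z (a k), b k := Z (b k))"
  have ne: "a k \<noteq> b k" "a k \<notin> a ` K" "a k \<notin> b ` K" "b k \<notin> a ` K" "b k \<notin> b ` K"
    using insert.prems(1-3) insert.hyps by auto
  have Y: "indep_vars (\<lambda>_. borel) ?Y I"
  proof (rule insert.IH)
    show "?Y (a l) = (\<lambda>\<omega>. Z (a l) \<omega> + Z (b l) \<omega>)" if "l \<in> K" for l
      using that ne insert.prems(9)[of l] by (auto simp: image_iff)
    show "?Y (b l) = (\<lambda>\<omega>. Z (a l) \<omega> - Z (b l) \<omega>)" if "l \<in> K" for l
      using that ne insert.prems(10)[of l] by (auto simp: image_iff)
    show "?Y i = Z i" if "i \<in> I" "i \<notin> a ` K" "i \<notin> b ` K" for i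
      using that insert.prems(11)[of i] by auto
  qed (use insert.prems in auto)
  have "indep_vars (\<lambda>_. borel) (?Y(a k := \<lambda>\<omega>. ?Y (a k) \<omega> + ?Y (b k) \<omega>, b k := \<lambda>\<omega>. ?Y (a k) \<omega> - ?Y (b k) \<omega>)) I"
    by (rule indep_vars_sum_diff[OF Y I _ _ ne(1) \<sigma>]) (use insert.prems ne in auto)
  also have "?Y(a k := \<lambda>\<omega>. ?Y (a k) \<omega> + ?Y (b k) \<omega>, b k := \<lambda>\<omega>. ?Y (a k) \<omega> - ?Y (b k) \<omega>) = Z'"
    using insert.prems(9,10)[of k] ne by auto
  finally show ?case .
qed

section \<open>Independence of the coefficients under the bridge law\<close>

definition dyadic_incr :: "real \<Rightarrow> (real \<Rightarrow> real) \<Rightarrow> nat \<Rightarrow> nat \<Rightarrow> real" where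
  "dyadic_incr T X r m = X (real (m + 1) * T / 2 ^ r) - X (real m * T / 2 ^ r)"

lemma dyadic_incr_split:
  "dyadic_incr T X r m = dyadic_incr T X (Suc r) (2 * m) + dyadic_incr T X (Suc r) (2 * m + 1)"
  "dyadic_diff T X r m = dyadic_incr T X (Suc r) (2 * m) - dyadic_incr T X (Suc r) (2 * m + 1)"
proof -
  have "2 * m + 1 + 1 = 2 * (m + 1)" by simp
  then show "dyadic_incr T X r m = dyadic_incr T X (Suc r) (2 * m) + dyadic_incr T X (Suc r) (2 * m + 1)"
    "dyadic_diff T X r m = dyadic_incr T X (Suc r) (2 * m) - dyadic_incr T X (Suc r) (2 * m + 1)"
    unfolding dyadic_incr_def dyadic_diff_def by (simp_all only: dyadic_double)
qed

text \<open>
  At stage \<open>r\<close> the index \<open>(0, m)\<close> stands for the \<open>m\<close>-th increment over the grid of mesh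
  \<open>T / 2 ^ r\<close> and \<open>(h + 1, d)\<close> for the second difference of level \<open>h\<close>. Passing from stage
  \<open>r + 1\<close> to stage \<open>r\<close> replaces neighbouring increments by their sum and difference.
\<close>

definition haar_index :: "nat \<Rightarrow> nat \<Rightarrow> (nat \<times> nat) set" where
  "haar_index N r = {0} \<times> {..<2 ^ r} \<union> (SIGMA e:{Suc r..Suc N}. {..<2 ^ (e - 1)})"

definition haar :: "real \<Rightarrow> nat \<Rightarrow> nat \<times> nat \<Rightarrow> (real \<Rightarrow> real) \<Rightarrow> real" where
  "haar T r p X = (case p of (e, m) \<Rightarrow>
     (case e of 0 \<Rightarrow> dyadic_incr T X r m | Suc h \<Rightarrow> dyadic_diff T X h m))"

lemma wiener_dyadic_incr_normal:
  assumes W: "wiener_measure T W" and T: "T > 0" and m: "m < 2 ^ r"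
  shows "distributed W lborel (\<lambda>X. dyadic_incr T X r m) (normal_density 0 (sqrt (T / 2 ^ r)))"
proof -
  let ?s = "real m * T / 2 ^ r" and ?t = "real (m + 1) * T / 2 ^ r"
  have "?t \<in> {0..T}" "?s \<in> {0..T}" using m by (intro dyadic_point_in[OF T]; simp)+
  then have "0 \<le> ?s" "?t \<le> T" by auto
  moreover have "?s < ?t" using T by (intro divide_strict_right_mono mult_strict_right_mono) auto
  moreover have "?t - ?s = T / 2 ^ r"
    by (simp add: diff_divide_distrib[symmetric] algebra_simps)
  moreover have "\<forall>s t. 0 \<le> s \<and> s < t \<and> t \<le> T \<longrightarrow>
        distributed W lborel (\<lambda>X. X t - X s) (normal_density 0 (sqrt (t - s)))"
    using W unfolding wiener_measure_def by blast
  ultimately show ?thesis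
    unfolding dyadic_incr_def by metis
qed

text \<open>Descent in \<open>r\<close>: at stage N + 1 only increments over successive grid
  intervals occur, independent by definition of the Wiener measure; each step down is one round of
  pairwise sums and differences.\<close>

lemma wiener_haar_indep:
  assumes W: "wiener_measure T W" and T: "T > 0" and "r \<le> Suc N"
  shows "prob_space.indep_vars W (\<lambda>_. borel) (haar T r) (haar_index N r)"
proof -
  interpret prob_space W using W by (simp add: wiener_measure_def)
  show ?thesis
    using assms(3)
  proof (induction r rule: inc_induct)
    case base
    let ?t = "\<lambda>m. real m * T / 2 ^ Suc N"
    have t: "0 \<le> ?t 0 \<and> (\<forall>m<2 ^ Suc N. ?t m < ?t (Suc m)) \<and> ?t (2 ^ Suc N) \<le> T"
      using T by (auto intro!: divide_strict_right_mono mult_strict_right_mono)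
    have "indep_vars (\<lambda>_. borel) (\<lambda>m X. X (?t (Suc m)) - X (?t m)) {..<2 ^ Suc N}"
    proof -
      have "\<forall>n (t :: nat \<Rightarrow> real). 0 \<le> t 0 \<and> (\<forall>m<n. t m < t (Suc m)) \<and> t n \<le> T \<longrightarrow>
          indep_vars (\<lambda>_. borel) (\<lambda>m X. X (t (Suc m)) - X (t m)) {..<n}"
        using W unfolding wiener_measure_def by (elim conjE)
      from this[THEN spec, of "2 ^ Suc N", THEN spec, of ?t, THEN mp, OF t] show ?thesis .
    qed
    then have "indep_vars (\<lambda>_. borel) (\<lambda>p X. X (?t (Suc (snd p))) - X (?t (snd p))) ({0::nat} \<times> {..<2 ^ Suc N})"
      by (rule indep_vars_reindex) (auto simp: inj_on_def)
    moreover have "haar_index N (Suc N) = {0} \<times> {..<2 ^ Suc N}"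
      by (auto simp: haar_index_def)
    moreover have "haar T (Suc N) p = (\<lambda>X. X (?t (Suc (snd p))) - X (?t (snd p)))"
      if "p \<in> {0} \<times> {..<2 ^ Suc N}" for p
      using that by (auto simp: haar_def[abs_def] dyadic_incr_def)
    ultimately show ?case
      using indep_vars_cong[OF refl, of "haar_index N (Suc N)" "haar T (Suc N)"] by simp
  next
    case (step r)
    \<comment> \<open>Injection of the indices of stage \<open>r\<close> into those of stage r + 1:
      the slot of a future sum points to the left neighbour 2 m, that of a future difference to the
      right neighbour 2 m + 1, all others stay. Parity separates the first two kinds.\<close>
    define f where "f = (\<lambda>(e::nat, m::nat). if e = 0 then (0::nat, 2 * m) else if e = Suc r then (0, 2 * m + 1) else (e, m))"
    have "f ` haar_index N r \<subseteq> haar_index N (Suc r)"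
      using step.hyps by (auto simp: f_def haar_index_def split: if_splits)
    moreover have "inj_on f (haar_index N r)"
    proof (rule inj_onI)
      fix p q assume "f p = f q"
      then show "p = q"
        by (cases p; cases q) (auto simp: f_def split: if_splits dest: arg_cong[of _ _ even])
    qed
    moreover have fin: "finite (haar_index N r)" by (auto simp: haar_index_def)
    ultimately have ind: "indep_vars (\<lambda>_. borel) (\<lambda>p. haar T (Suc r) (f p)) (haar_index N r)"
      by (intro indep_vars_reindex[OF step.IH])
    show ?case
    proof (rule indep_vars_sum_diff_pairs[OF ind fin, where K = "{..<2 ^ r}" and a = "\<lambda>m. (0, m)"
          and b = "\<lambda>m. (Suc r, m)" and \<sigma> = "sqrt (T / 2 ^ Suc r)"])
      fix m :: nat assume m: "m \<in> {..<2 ^ r}"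
      then have "2 * m < 2 ^ Suc r" "2 * m + 1 < 2 ^ Suc r" by auto
      from this[THEN wiener_dyadic_incr_normal[OF W T]]
      show "distributed W lborel (haar T (Suc r) (f (0, m))) (normal_density 0 (sqrt (T / 2 ^ Suc r)))"
        "distributed W lborel (haar T (Suc r) (f (Suc r, m))) (normal_density 0 (sqrt (T / 2 ^ Suc r)))"
        by (simp_all add: haar_def[abs_def] f_def)
      show "haar T r (0, m) = (\<lambda>X. haar T (Suc r) (f (0, m)) X + haar T (Suc r) (f (Suc r, m)) X)"
        "haar T r (Suc r, m) = (\<lambda>X. haar T (Suc r) (f (0, m)) X - haar T (Suc r) (f (Suc r, m)) X)"
        by (simp_all add: haar_def[abs_def] f_def dyadic_incr_split[of T _ r])
    next
      fix p assume "p \<in> haar_index N r" "p \<notin> (\<lambda>m. (0, m)) ` {..<2 ^ r}" "p \<notin> (\<lambda>m. (Suc r, m)) ` {..<2 ^ r}"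
      then obtain e m where "p = (e, m)" "e \<noteq> 0" "e \<noteq> Suc r"
        by (cases p; cases "fst p = Suc r") (auto simp: haar_index_def image_iff)
      then show "haar T r p = haar T (Suc r) (f p)"
        by (cases e) (auto simp: haar_def[abs_def] f_def)
    qed (use T step.hyps in \<open>auto simp: inj_on_def haar_index_def\<close>)
  qed
qed

definition fs_index :: "nat \<Rightarrow> (nat \<times> nat) set" where
  "fs_index N = (SIGMA h:{..N}. {..<2 ^ h})"

lemma finite_fs_index [simp]: "finite (fs_index N)"
  by (simp add: fs_index_def)

text \<open>Stage 0 of the scheme with index (0, 0) left out: that entry is the total increment,
  which the bridge prescribes.\<close>

lemma wiener_dyadic_diff_indep:
  assumes W: "wiener_measure T W" and T: "T > 0"
  shows "prob_space.indep_vars W (\<lambda>_. borel) (\<lambda>p X. dyadic_diff T X (fst p) (snd p)) (fs_index N)"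
proof -
  interpret prob_space W using W by (simp add: wiener_measure_def)
  have "indep_vars (\<lambda>_. borel) (\<lambda>p. haar T 0 (Suc (fst p), snd p)) (fs_index N)"
    by (rule indep_vars_reindex[OF wiener_haar_indep[OF W T]])
      (auto simp: fs_index_def haar_index_def inj_on_def)
  then show ?thesis by (simp add: haar_def[abs_def])
qed

section \<open>Transfer from the Wiener measure to the bridge law\<close>

lemma space_path_space: "space (path_space T) = {X \<in> extensional {0..T}. continuous_on {0..T} X}"
  by (auto simp: path_space_def space_restrict_space space_PiM PiE_def)

lemma measurable_path_eval:
  assumes "t \<in> {0..T}" shows "(\<lambda>X. X t) \<in> borel_measurable (path_space T)"
  unfolding path_space_def
  by (rule measurable_restrict_space1, rule measurable_component_singleton, rule assms)

text \<open>Paths in \<open>path_space T\<close> are continuous, so the implicit coefficient may be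
  replaced there by a combination of three evaluations.\<close>

lemma measurable_fs_coeff:
  assumes T: "T > 0" shows "(\<lambda>X. fs_coeff T X h d) \<in> borel_measurable (path_space T)"
proof -
  have "(\<lambda>X. schauder_coeff T X h d) \<in> borel_measurable (path_space T)"
  proof (cases "d < 2 ^ h")
    case True
    then have "2 * d + 1 \<le> 2 ^ Suc h" "d \<le> 2 ^ h" "d + 1 \<le> 2 ^ h" by auto
    from this[THEN dyadic_point_in[OF T], THEN measurable_path_eval] show ?thesis
      using True unfolding schauder_coeff_def dyadic_diff_def by simp
  qed (simp add: schauder_coeff_def)
  then show ?thesis
    by (rule measurable_cong[THEN iffD1, rotated]) (simp add: fs_coeff_eq[OF T] space_path_space)
qed

definition bridge_map :: "real \<Rightarrow> real \<Rightarrow> real \<Rightarrow> (real \<Rightarrow> real) \<Rightarrow> real \<Rightarrow> real" where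
  "bridge_map T u v X = (\<lambda>t\<in>{0..T}. (1 - t / T) * u + t / T * v + (X t - t / T * X T))"

lemma measurable_bridge_map:
  assumes T: "T > 0"
  shows "bridge_map T u v \<in> measurable (path_space T) (path_space T)"
proof -
  have "bridge_map T u v \<in> measurable (path_space T) (Pi\<^sub>M {0..T} (\<lambda>_. borel))"
    unfolding bridge_map_def
  proof (rule measurable_restrict)
    fix t assume "t \<in> {0..T}"
    have "T \<in> {0..T}" using T by simp
    note [measurable] = measurable_path_eval[OF this] measurable_path_eval[OF \<open>t \<in> {0..T}\<close>]
    show "(\<lambda>X. (1 - t / T) * u + t / T * v + (X t - t / T * X T)) \<in> borel_measurable (path_space T)"
      using T by measurable
  qed
  moreover have "continuous_on {0..T} (bridge_map T u v X)" if "X \<in> space (path_space T)" for X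
  proof -
    have X: "continuous_on {0..T} X" using that by (simp add: space_path_space)
    have "continuous_on {0..T} (\<lambda>t. (1 - t / T) * u + t / T * v + (X t - t / T * X T))"
      using T by (intro continuous_intros X) auto
    then show ?thesis
      unfolding bridge_map_def by (subst continuous_on_cong[OF refl restrict_apply']) auto
  qed
  ultimately have "bridge_map T u v \<in> measurable (path_space T) (restrict_space (Pi\<^sub>M {0..T} (\<lambda>_. borel)) {X. continuous_on {0..T} X})"
    by (intro measurable_restrict_space2) auto
  then show ?thesis by (simp add: path_space_def)
qed

text \<open>On the interval the map adds an affine function. Its slope depends on the path through
  \<open>X T\<close>, but for each fixed path second differences annihilate it.\<close>

lemma dyadic_diff_bridge_map:
  assumes T: "T > 0" and d: "d < 2 ^ h"
  shows "dyadic_diff T (bridge_map T u v X) h d = dyadic_diff T X h d"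
proof -
  have "bridge_map T u v X t = ((1 - t / T) * u + t / T * (v - X T)) + X t" if "t \<in> {0..T}" for t
    using that by (simp add: bridge_map_def algebra_simps)
  then have "dyadic_diff T (bridge_map T u v X) h d = dyadic_diff T (\<lambda>t. ((1 - t / T) * u + t / T * (v - X T)) + X t) h d"
    using dyadic_point_in[OF T] by (intro dyadic_diff_cong d) blast
  also have "\<dots> = dyadic_diff T (\<lambda>t. (1 - t / T) * u + t / T * (v - X T)) h d + dyadic_diff T X h d"
    unfolding dyadic_diff_def by (simp add: algebra_simps)
  also have "\<dots> = dyadic_diff T X h d"
    using dyadic_diff_affine[OF T affine_on_cell_linear] by simp
  finally show ?thesis .
qed

lemma bridge_fs_coeff_indep:
  assumes Q: "brownian_bridge_law T u v Q" and T: "T > 0"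
  shows "prob_space Q" "sets Q = sets (path_space T)"
    "prob_space.indep_vars Q (\<lambda>_. borel) (\<lambda>p X. fs_coeff T X (fst p) (snd p)) (fs_index N)"
proof -
  obtain W where W: "wiener_measure T W" and Q_eq: "Q = distr W (path_space T) (bridge_map T u v)"
    using Q unfolding brownian_bridge_law_def bridge_map_def[abs_def] by blast
  interpret prob_space W using W by (simp add: wiener_measure_def)
  have sets_W: "sets W = sets (path_space T)" using W by (simp add: wiener_measure_def)
  then have rv: "random_variable (path_space T) (bridge_map T u v)"
    using measurable_bridge_map[OF T] by (simp cong: measurable_cong_sets)
  show "prob_space Q" unfolding Q_eq using rv by (rule prob_space_distr)
  show "sets Q = sets (path_space T)" by (simp add: Q_eq)
  have scaled: "indep_vars (\<lambda>_. borel) (\<lambda>p X. 2 powr (real (fst p) / 2) / sqrt T * dyadic_diff T X (fst p) (snd p)) (fs_index N)"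
    by (rule indep_vars_compose2[OF wiener_dyadic_diff_indep[OF W T]]) simp
  have eq: "fs_coeff T (bridge_map T u v X) (fst p) (snd p) = 2 powr (real (fst p) / 2) / sqrt T * dyadic_diff T X (fst p) (snd p)"
    if "p \<in> fs_index N" "X \<in> space W" for p X
  proof -
    have "bridge_map T u v X \<in> space (path_space T)"
      using measurable_space[OF rv that(2)] .
    then show ?thesis
      using that(1) by (auto simp: fs_coeff_eq[OF T] space_path_space schauder_coeff_def fs_index_def
          dyadic_diff_bridge_map[OF T])
  qed
  have ind: "indep_vars (\<lambda>_. borel) (\<lambda>p X. fs_coeff T (bridge_map T u v X) (fst p) (snd p)) (fs_index N)"
    by (rule indep_vars_cong_space[OF scaled finite_fs_index], rule eq[symmetric])
  show "prob_space.indep_vars Q (\<lambda>_. borel) (\<lambda>p X. fs_coeff T X (fst p) (snd p)) (fs_index N)"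
    unfolding Q_eq
  proof (rule indep_vars_distr[where X = "\<lambda>p X. fs_coeff T X (fst p) (snd p)", OF finite_fs_index rv])
    show "indep_vars (\<lambda>_. borel) (\<lambda>p X. fs_coeff T (bridge_map T u v X) (fst p) (snd p)) (fs_index N)"
      by (rule ind)
    show "(\<lambda>X. fs_coeff T X (fst p) (snd p)) \<in> borel_measurable (path_space T)" for p
      by (rule measurable_fs_coeff[OF T])
  qed
qed

section \<open>Conditional independence under a factorizing density\<close>

text \<open>Hypothesis \<open>eq\<close> says that \<open>K A\<close> is a version of the
  conditional probability of X in A given \<open>F\<close> and \<open>Y\<close> together. As
  \<open>K A\<close> is measurable for \<open>F\<close> alone, \<open>Y\<close> adds no information
  on \<open>X\<close>.\<close>

lemma cond_indep_varI:
  assumes P: "prob_space P" and sub: "subalgebra P F"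
    and X [measurable]: "X \<in> borel_measurable P" and Y [measurable]: "Y \<in> borel_measurable P"
    and K: "\<And>A. A \<in> sets borel \<Longrightarrow> K A \<in> borel_measurable F" "\<And>A \<omega>. A \<in> sets borel \<Longrightarrow> 0 \<le> K A \<omega> \<and> K A \<omega> \<le> (1::real)"
    and eq: "\<And>A B G. A \<in> sets borel \<Longrightarrow> B \<in> sets borel \<Longrightarrow> G \<in> sets F \<Longrightarrow>
      measure P {\<omega>\<in>space P. X \<omega> \<in> A \<and> Y \<omega> \<in> B \<and> \<omega> \<in> G} = (\<integral>\<omega>. K A \<omega> * indicator {\<omega>\<in>space P. Y \<omega> \<in> B \<and> \<omega> \<in> G} \<omega> \<partial>P)"
  shows "cond_indep_var P F X Y"
proof -
  interpret prob_space P by fact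
  interpret finite_measure_subalgebra P F by standard (rule sub)
  have "AE \<omega> in P. real_cond_exp P F (indicator {\<omega>\<in>space P. X \<omega> \<in> A \<and> Y \<omega> \<in> B}) \<omega> =
        real_cond_exp P F (indicator {\<omega>\<in>space P. X \<omega> \<in> A}) \<omega> *
        real_cond_exp P F (indicator {\<omega>\<in>space P. Y \<omega> \<in> B}) \<omega>"
    if [measurable]: "A \<in> sets borel" "B \<in> sets borel" for A B :: "real set"
  proof -
    have KF [measurable]: "K A \<in> borel_measurable F" by (rule K) fact
    have KP [measurable]: "K A \<in> borel_measurable P"
      by (rule measurable_from_subalg[OF sub KF])
    have int_KI: "integrable P (\<lambda>\<omega>. K A \<omega> * indicator C \<omega>)" if [measurable]: "C \<in> sets P" for C
      using K(2)[of A] by (intro integrable_const_bound[where B = 1]) (auto split: split_indicator)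
    have FP: "G \<in> sets P" if "G \<in> sets F" for G
      using that sub by (auto simp: subalgebra_def)
    have cond_KY: "AE \<omega> in P. real_cond_exp P F (indicator {\<omega>\<in>space P. X \<omega> \<in> A \<and> Y \<omega> \<in> C}) \<omega>
        = real_cond_exp P F (\<lambda>\<omega>. K A \<omega> * indicator {\<omega>\<in>space P. Y \<omega> \<in> C} \<omega>) \<omega>"
      if [measurable]: "C \<in> sets borel" for C
    proof (rule real_cond_exp_charact)
      fix G assume G: "G \<in> sets F"
      note [measurable] = FP[OF G]
      let ?h = "\<lambda>\<omega>. K A \<omega> * indicator {\<omega>\<in>space P. Y \<omega> \<in> C} \<omega>"
      have "(\<integral>\<omega>\<in>G. indicator {\<omega>\<in>space P. X \<omega> \<in> A \<and> Y \<omega> \<in> C} \<omega> \<partial>P)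
          = (\<integral>\<omega>. indicator {\<omega>\<in>space P. X \<omega> \<in> A \<and> Y \<omega> \<in> C \<and> \<omega> \<in> G} \<omega> \<partial>P)"
        unfolding set_lebesgue_integral_def
        by (intro Bochner_Integration.integral_cong) (auto split: split_indicator)
      also have "\<dots> = measure P {\<omega>\<in>space P. X \<omega> \<in> A \<and> Y \<omega> \<in> C \<and> \<omega> \<in> G}"
        by (subst Bochner_Integration.integral_indicator) (auto intro!: arg_cong[where f = "measure P"])
      also have "\<dots> = (\<integral>\<omega>. K A \<omega> * indicator {\<omega>\<in>space P. Y \<omega> \<in> C \<and> \<omega> \<in> G} \<omega> \<partial>P)"
        by (rule eq) (use G in auto)
      also have "\<dots> = (\<integral>\<omega>\<in>G. ?h \<omega> \<partial>P)"
        unfolding set_lebesgue_integral_def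
        by (intro Bochner_Integration.integral_cong) (auto split: split_indicator)
      also have "\<dots> = (\<integral>\<omega>\<in>G. real_cond_exp P F ?h \<omega> \<partial>P)"
        by (rule real_cond_exp_intA[OF int_KI G]) measurable
      finally show "(\<integral>\<omega>\<in>G. indicator {\<omega>\<in>space P. X \<omega> \<in> A \<and> Y \<omega> \<in> C} \<omega> \<partial>P) = (\<integral>\<omega>\<in>G. real_cond_exp P F ?h \<omega> \<partial>P)" .
    next
      show "integrable P (real_cond_exp P F (\<lambda>\<omega>. K A \<omega> * indicator {\<omega>\<in>space P. Y \<omega> \<in> C} \<omega>))"
        by (rule real_cond_exp_int(1)[OF int_KI]) measurable
      show "integrable P (indicator {\<omega>\<in>space P. X \<omega> \<in> A \<and> Y \<omega> \<in> C} :: _ \<Rightarrow> real)"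
        by (rule integrable_real_indicator) (auto simp: emeasure_eq_measure)
    qed simp
    have "AE \<omega> in P. real_cond_exp P F (\<lambda>\<omega>. K A \<omega> * indicator {\<omega>\<in>space P. Y \<omega> \<in> C} \<omega>) \<omega>
        = K A \<omega> * real_cond_exp P F (indicator {\<omega>\<in>space P. Y \<omega> \<in> C}) \<omega>"
      if [measurable]: "C \<in> sets borel" for C
      by (rule real_cond_exp_mult[OF KF _ int_KI]) measurable
    note pull = this
    have "AE \<omega> in P. real_cond_exp P F (indicator (space P)) \<omega> = (1::real)"
    proof -
      have "AE \<omega> in P. real_cond_exp P F (\<lambda>_. 1) \<omega> = (1::real)"
        by (rule real_cond_exp_F_meas) auto
      moreover have "AE \<omega> in P. real_cond_exp P F (indicator (space P)) \<omega> = real_cond_exp P F (\<lambda>_. 1) \<omega>"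
        by (rule real_cond_exp_cong) auto
      ultimately show ?thesis by eventually_elim simp
    qed
    \<comment> \<open>The choice \<open>UNIV\<close> identifies \<open>K A\<close> with the
      conditional probability of X in A given \<open>F\<close>; the choice \<open>B\<close> then
      gives the product formula.\<close>
    with cond_KY[of UNIV] pull[of UNIV] have "AE \<omega> in P. real_cond_exp P F (indicator {\<omega>\<in>space P. X \<omega> \<in> A}) \<omega> = K A \<omega>"
      by auto
    with cond_KY[of B] pull[of B] show ?thesis by auto
  qed
  then show ?thesis
    unfolding cond_indep_var_def using P sub X Y by blast
qed

lemma (in prob_space) nn_integral_indep_var:
  assumes ind: "indep_var ME E MV V" and [measurable]: "\<phi> \<in> borel_measurable (ME \<Otimes>\<^sub>M MV)"
  shows "(\<integral>\<^sup>+\<omega>. \<phi> (E \<omega>, V \<omega>) \<partial>M) = (\<integral>\<^sup>+e. \<integral>\<^sup>+v. \<phi> (e, v) \<partial>distr M MV V \<partial>distr M ME E)"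
proof -
  have [measurable]: "random_variable ME E" "random_variable MV V"
    using ind by (auto dest: indep_var_rv1 indep_var_rv2)
  interpret DV: prob_space "distr M MV V" by (rule prob_space_distr) measurable
  have eq: "distr M ME E \<Otimes>\<^sub>M distr M MV V = distr M (ME \<Otimes>\<^sub>M MV) (\<lambda>\<omega>. (E \<omega>, V \<omega>))"
    using ind by (simp add: indep_var_distribution_eq)
  have "(\<integral>\<^sup>+\<omega>. \<phi> (E \<omega>, V \<omega>) \<partial>M) = (\<integral>\<^sup>+p. \<phi> p \<partial>distr M (ME \<Otimes>\<^sub>M MV) (\<lambda>\<omega>. (E \<omega>, V \<omega>)))"
    by (subst nn_integral_distr) auto
  also have "\<dots> = (\<integral>\<^sup>+e. \<integral>\<^sup>+v. \<phi> (e, v) \<partial>distr M MV V \<partial>distr M ME E)"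
    unfolding eq[symmetric] by (rule DV.nn_integral_fst[symmetric]) simp
  finally show ?thesis .
qed

text \<open>By independence, the law of \<open>V\<close> given \<open>E\<close> under the new
  measure has a density proportional to f(r(E), .) with respect to its old law, so \<open>E\<close>
  enters only through \<open>r\<close>. Bounds and strict positivity make the total mass and the
  conditional normalizers finite and nonzero.\<close>

lemma (in prob_space) cond_indep_var_density:
  fixes E :: "'a \<Rightarrow> 'e" and V :: "'a \<Rightarrow> 'e" and r :: "'e \<Rightarrow> 'r" and f :: "'r \<Rightarrow> 'e \<Rightarrow> real"
    and g :: "'e \<Rightarrow> real" and x :: "'e \<Rightarrow> real" and y :: "'e \<Rightarrow> real"
  assumes ind: "indep_var ME E MV V"
    and r [measurable]: "r \<in> measurable ME MR"
    and [measurable]: "(\<lambda>(u, v). f u v) \<in> borel_measurable (MR \<Otimes>\<^sub>M MV)" "g \<in> borel_measurable ME"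
      "x \<in> borel_measurable MV" "y \<in> borel_measurable ME"
    and f: "\<And>u v. 0 < f u v" "\<And>u v. f u v \<le> Cf" and g: "\<And>e. 0 < g e" "\<And>e. g e \<le> Cg"
  defines "w \<equiv> \<lambda>\<omega>. f (r (E \<omega>)) (V \<omega>) * g (E \<omega>)"
  defines "P \<equiv> density M (\<lambda>\<omega>. ennreal (w \<omega> / (\<integral>\<omega>. w \<omega> \<partial>M)))"
  shows "cond_indep_var P (vimage_algebra (space M) (\<lambda>\<omega>. r (E \<omega>)) MR) (\<lambda>\<omega>. x (V \<omega>)) (\<lambda>\<omega>. y (E \<omega>))"
proof -
  have E [measurable]: "random_variable ME E" and V [measurable]: "random_variable MV V"
    using ind by (auto dest: indep_var_rv1 indep_var_rv2)
  have fm [measurable]: "(\<lambda>z. f (h z) (k z)) \<in> borel_measurable N"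
    if "h \<in> measurable N MR" "k \<in> measurable N MV" for h k and N :: "'z measure"
    using measurable_compose[OF measurable_Pair[OF that], of "\<lambda>(u, v). f u v" borel] assms(3) by simp
  have w_pos: "0 < w \<omega>" for \<omega> using f g by (simp add: w_def)
  have w_le: "w \<omega> \<le> Cf * Cg" for \<omega>
    unfolding w_def using f g less_le_trans[OF f] by (intro mult_mono) (auto intro: less_imp_le)
  have wm [measurable]: "w \<in> borel_measurable M" unfolding w_def by measurable
  have w_int: "integrable M w"
    using w_pos w_le by (intro integrable_const_bound[where B = "Cf * Cg"]) (auto simp: less_imp_le abs_of_pos)
  define c where "c = (\<integral>\<omega>. w \<omega> \<partial>M)"
  have c: "c > 0"
  proof -
    have "c \<noteq> 0"
    proof
      assume "c = 0"
      then have "AE \<omega> in M. w \<omega> = 0"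
        unfolding c_def using w_int w_pos by (subst (asm) integral_nonneg_eq_0_iff_AE) (auto simp: less_imp_le)
      then have "AE \<omega> in M. False" by (rule eventually_mono) (use w_pos in \<open>auto simp: less_le\<close>)
      then show False by simp
    qed
    moreover have "c \<ge> 0" unfolding c_def by (intro integral_nonneg_AE) (auto simp: less_imp_le w_pos)
    ultimately show ?thesis by simp
  qed
  have P_def: "P = density M (\<lambda>\<omega>. ennreal (w \<omega> / c))" by (simp add: P_def c_def)
  have sets_P [measurable_cong]: "sets P = sets M" and space_P: "space P = space M" by (simp_all add: P_def)
  have "emeasure P (space P) = 1"
  proof -
    have "emeasure P (space P) = (\<integral>\<^sup>+\<omega>. ennreal (w \<omega> / c) \<partial>M)"
      unfolding P_def by (subst emeasure_density) (auto intro!: nn_integral_cong)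
    also have "\<dots> = ennreal (\<integral>\<omega>. w \<omega> / c \<partial>M)"
      using w_int w_pos c by (intro nn_integral_eq_integral) (auto simp: less_imp_le)
    also have "\<dots> = 1" using c by (simp add: c_def)
    finally show ?thesis .
  qed
  then interpret P: prob_space P by (rule prob_spaceI)
  define \<mu> where "\<mu> = distr M MV V"
  interpret \<mu>: prob_space \<mu> unfolding \<mu>_def by (rule prob_space_distr) measurable
  have [measurable_cong]: "sets \<mu> = sets MV" by (simp add: \<mu>_def)
  \<comment> \<open>Unnormalized conditional mass of the event x(V) in A given r(E) = u;
    \<open>a UNIV\<close> is the normalizer.\<close>
  define a where "a = (\<lambda>A u. \<integral>\<^sup>+v. ennreal (f u v) * indicator A (x v) \<partial>\<mu>)"
  have am [measurable]: "a A \<in> borel_measurable MR" if [measurable]: "A \<in> sets borel" for A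
    unfolding a_def by measurable
  have a_pos: "a UNIV u \<noteq> 0" if "u \<in> space MR" for u
  proof
    assume "a UNIV u = 0"
    have "(\<lambda>v. ennreal (f u v)) \<in> borel_measurable \<mu>" using that by measurable
    then have "AE v in \<mu>. ennreal (f u v) = 0"
      using \<open>a UNIV u = 0\<close> by (simp add: a_def nn_integral_0_iff_AE)
    then have "AE v in \<mu>. False"
      by (rule eventually_mono) (use f(1) in \<open>metis ennreal_eq_0_iff not_le\<close>)
    then show False by simp
  qed
  have a_fin: "a UNIV u \<noteq> \<infinity>" for u
  proof -
    have "a UNIV u \<le> (\<integral>\<^sup>+v. ennreal Cf \<partial>\<mu>)"
      unfolding a_def using f by (intro nn_integral_mono) (auto intro: ennreal_leI)
    also have "\<dots> < \<infinity>" by (simp add: \<mu>.emeasure_space_1)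
    finally show ?thesis by simp
  qed
  have a_mono: "a A u \<le> a UNIV u" for A u
    unfolding a_def by (intro nn_integral_mono) (auto split: split_indicator)
  \<comment> \<open>The conditional probability of \<open>x V \<in> A\<close> given \<open>r E = u\<close>. The factor \<open>g\<close> cancels, so that
    it is also the conditional probability given all of \<open>E\<close>.\<close>
  define k where "k = (\<lambda>A u. enn2real (a A u / a UNIV u))"
  have k_meas [measurable]: "k A \<in> borel_measurable MR" if [measurable]: "A \<in> sets borel" for A
    unfolding k_def by measurable
  have k_eq: "ennreal (k A u) * a UNIV u = a A u" and k_le: "0 \<le> k A u \<and> k A u \<le> 1"
    if u: "u \<in> space MR" for A u
  proof -
    have self: "a UNIV u / a UNIV u = 1"
      using a_pos[OF u] a_fin[of u] by (intro ennreal_divide_self) (auto simp: top.not_eq_extremum)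
    have "a A u / a UNIV u \<le> a UNIV u / a UNIV u"
      by (rule divide_right_mono_ennreal[OF a_mono])
    then have le: "a A u / a UNIV u \<le> 1" unfolding self .
    then have fin: "a A u / a UNIV u < \<top>" by (rule le_less_trans) simp
    then have "ennreal (k A u) * a UNIV u = a A u / a UNIV u * a UNIV u" by (simp add: k_def)
    also have "\<dots> = a A u" unfolding ennreal_divide_times self by simp
    finally show "ennreal (k A u) * a UNIV u = a A u" .
    show "0 \<le> k A u \<and> k A u \<le> 1"
      unfolding k_def using le by (auto intro!: enn2real_leI)
  qed
  \<comment> \<open>The defining property of a conditional probability, tested against functions of
    all of \<open>E\<close> and not only of r(E); this covers the second variable y(E).\<close>
  have key: "(\<integral>\<^sup>+\<omega>. indicator A (x (V \<omega>)) * h (E \<omega>) \<partial>P) = (\<integral>\<^sup>+\<omega>. ennreal (k A (r (E \<omega>))) * h (E \<omega>) \<partial>P)"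
    if [measurable]: "A \<in> sets borel" "h \<in> borel_measurable ME" for A h
  proof -
    \<comment> \<open>Fubini under the product law, applied twice: to the indicator of the event and
      to its conditional probability.\<close>
    have dens: "(\<integral>\<^sup>+\<omega>. \<psi> (E \<omega>) (V \<omega>) * h (E \<omega>) \<partial>P)
        = (\<integral>\<^sup>+e. (\<integral>\<^sup>+v. ennreal (f (r e) v) * \<psi> e v \<partial>\<mu>) * (ennreal (g e / c) * h e) \<partial>distr M ME E)"
      if m [measurable]: "(\<lambda>(e, v). \<psi> e v) \<in> borel_measurable (ME \<Otimes>\<^sub>M MV)" for \<psi> :: "'e \<Rightarrow> 'e \<Rightarrow> ennreal"
    proof -
      have [measurable]: "(\<lambda>z. \<psi> (h z) (k z)) \<in> borel_measurable N"
        if "h \<in> measurable N ME" "k \<in> measurable N MV" for h k and N :: "'z measure"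
        using measurable_compose[OF measurable_Pair[OF that] m] by simp
      have \<psi>v: "(\<lambda>v. \<psi> e v) \<in> borel_measurable MV" "(\<lambda>v. f (r e) v) \<in> borel_measurable MV" if "e \<in> space ME" for e
        using that by measurable
      let ?\<phi> = "\<lambda>p. ennreal (f (r (fst p)) (snd p)) * \<psi> (fst p) (snd p) * (ennreal (g (fst p) / c) * h (fst p))"
      have "(\<integral>\<^sup>+\<omega>. \<psi> (E \<omega>) (V \<omega>) * h (E \<omega>) \<partial>P) = (\<integral>\<^sup>+\<omega>. ?\<phi> (E \<omega>, V \<omega>) \<partial>M)"
      proof -
        have "ennreal (w \<omega> / c) = ennreal (f (r (E \<omega>)) (V \<omega>)) * ennreal (g (E \<omega>) / c)" for \<omega>
          using f(1) g(1) c by (simp add: w_def ennreal_mult'[symmetric] less_imp_le)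
        then show ?thesis
          unfolding P_def by (subst nn_integral_density) (auto simp: mult_ac)
      qed
      also have "\<dots> = (\<integral>\<^sup>+e. \<integral>\<^sup>+v. ?\<phi> (e, v) \<partial>\<mu> \<partial>distr M ME E)"
        unfolding \<mu>_def by (rule nn_integral_indep_var[OF ind]) measurable
      also have "\<dots> = (\<integral>\<^sup>+e. (\<integral>\<^sup>+v. ennreal (f (r e) v) * \<psi> e v \<partial>\<mu>) * (ennreal (g e / c) * h e) \<partial>distr M ME E)"
      proof (rule nn_integral_cong)
        fix e assume "e \<in> space (distr M ME E)"
        then have [measurable]: "(\<lambda>v. \<psi> e v) \<in> borel_measurable MV" "(\<lambda>v. f (r e) v) \<in> borel_measurable MV"
          using \<psi>v[of e] by auto
        show "(\<integral>\<^sup>+v. ?\<phi> (e, v) \<partial>\<mu>) = (\<integral>\<^sup>+v. ennreal (f (r e) v) * \<psi> e v \<partial>\<mu>) * (ennreal (g e / c) * h e)"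
          by (simp, rule nn_integral_multc) measurable
      qed
      finally show ?thesis .
    qed
    have "(\<integral>\<^sup>+\<omega>. indicator A (x (V \<omega>)) * h (E \<omega>) \<partial>P)
      = (\<integral>\<^sup>+e. a A (r e) * (ennreal (g e / c) * h e) \<partial>distr M ME E)"
      unfolding a_def by (rule dens[of "\<lambda>e v. indicator A (x v)"]) measurable
    also have "\<dots> = (\<integral>\<^sup>+e. (\<integral>\<^sup>+v. ennreal (f (r e) v) * ennreal (k A (r e)) \<partial>\<mu>) * (ennreal (g e / c) * h e) \<partial>distr M ME E)"
    proof (rule nn_integral_cong)
      fix e assume "e \<in> space (distr M ME E)"
      then have e: "e \<in> space ME" by simp
      then have re: "r e \<in> space MR" using measurable_space[OF r] by blast
      have [measurable]: "(\<lambda>v. f (r e) v) \<in> borel_measurable MV" using e by measurable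
      have "(\<integral>\<^sup>+v. ennreal (f (r e) v) * ennreal (k A (r e)) \<partial>\<mu>) = (\<integral>\<^sup>+v. ennreal (f (r e) v) \<partial>\<mu>) * ennreal (k A (r e))"
        by (rule nn_integral_multc) measurable
      also have "\<dots> = a A (r e)" using k_eq[OF re, of A] by (simp add: a_def mult.commute)
      finally show "a A (r e) * (ennreal (g e / c) * h e) = (\<integral>\<^sup>+v. ennreal (f (r e) v) * ennreal (k A (r e)) \<partial>\<mu>) * (ennreal (g e / c) * h e)"
        by simp
    qed
    also have "\<dots> = (\<integral>\<^sup>+\<omega>. ennreal (k A (r (E \<omega>))) * h (E \<omega>) \<partial>P)"
      by (rule dens[of "\<lambda>e v. ennreal (k A (r e))", symmetric]) measurable
    finally show ?thesis .
  qed
  define F where "F = vimage_algebra (space M) (\<lambda>\<omega>. r (E \<omega>)) MR"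
  have rE: "(\<lambda>\<omega>. r (E \<omega>)) \<in> space M \<rightarrow> space MR"
    using measurable_space[OF measurable_compose[OF E r]] by auto
  have sets_F: "sets F = {(\<lambda>\<omega>. r (E \<omega>)) -` S \<inter> space M | S. S \<in> sets MR}"
    unfolding F_def by (rule sets_vimage_algebra2[OF rE])
  have rE_F: "(\<lambda>\<omega>. r (E \<omega>)) \<in> measurable F MR"
    unfolding F_def by (rule measurable_vimage_algebra1[OF rE])
  have "cond_indep_var P F (\<lambda>\<omega>. x (V \<omega>)) (\<lambda>\<omega>. y (E \<omega>))"
  \<comment> \<open>The clamp to [0, 1] is there because \<open>k_le\<close> holds only for
    arguments in \<open>space MR\<close>, while the rule asks for bounds at every point. On
    \<open>space M\<close> it changes nothing.\<close>
  proof (rule cond_indep_varI[where K = "\<lambda>A \<omega>. min 1 (max 0 (k A (r (E \<omega>))))"])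
    show "prob_space P" by (rule P.prob_space_axioms)
    show "subalgebra P F"
      unfolding subalgebra_def using sets_F measurable_compose[OF E r]
      by (auto simp: F_def space_P sets_P intro: measurable_sets)
    show "(\<lambda>\<omega>. x (V \<omega>)) \<in> borel_measurable P" "(\<lambda>\<omega>. y (E \<omega>)) \<in> borel_measurable P" by measurable
    show "(\<lambda>\<omega>. min 1 (max 0 (k A (r (E \<omega>))))) \<in> borel_measurable F" if [measurable]: "A \<in> sets borel" for A
    proof -
      have "(\<lambda>\<omega>. k A (r (E \<omega>))) \<in> borel_measurable F"
        by (rule measurable_compose[OF rE_F k_meas[OF that]])
      then show ?thesis by measurable
    qed
    show "0 \<le> min 1 (max 0 (k A (r (E \<omega>)))) \<and> min 1 (max 0 (k A (r (E \<omega>)))) \<le> 1" for A \<omega> by auto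
    fix A B :: "real set" and G assume [measurable]: "A \<in> sets borel" "B \<in> sets borel" and "G \<in> sets F"
    then obtain S where S [measurable]: "S \<in> sets MR" and G: "G = (\<lambda>\<omega>. r (E \<omega>)) -` S \<inter> space M"
      unfolding sets_F by blast
    define h :: "'e \<Rightarrow> ennreal" where "h = (\<lambda>e. indicator B (y e) * indicator S (r e))"
    have [measurable]: "h \<in> borel_measurable ME" unfolding h_def by measurable
    let ?C = "{\<omega>\<in>space P. x (V \<omega>) \<in> A \<and> y (E \<omega>) \<in> B \<and> \<omega> \<in> G}" and ?D = "{\<omega>\<in>space P. y (E \<omega>) \<in> B \<and> \<omega> \<in> G}"
    have [measurable]: "G \<in> sets P"
      unfolding G sets_P by (rule measurable_sets[OF measurable_compose[OF E r] S])
    have "ennreal (P.prob ?C) = (\<integral>\<^sup>+\<omega>. indicator ?C \<omega> \<partial>P)"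
      by (simp add: P.emeasure_eq_measure)
    also have "\<dots> = (\<integral>\<^sup>+\<omega>. indicator A (x (V \<omega>)) * h (E \<omega>) \<partial>P)"
      by (intro nn_integral_cong) (auto simp: h_def G space_P split: split_indicator)
    also have "\<dots> = (\<integral>\<^sup>+\<omega>. ennreal (k A (r (E \<omega>))) * h (E \<omega>) \<partial>P)"
      by (rule key) measurable
    also have "\<dots> = (\<integral>\<^sup>+\<omega>. ennreal (min 1 (max 0 (k A (r (E \<omega>)))) * indicator ?D \<omega>) \<partial>P)"
      using rE k_le by (intro nn_integral_cong) (auto simp: h_def G space_P Pi_iff split: split_indicator)
    also have "\<dots> = ennreal (\<integral>\<omega>. min 1 (max 0 (k A (r (E \<omega>)))) * indicator ?D \<omega> \<partial>P)"
      by (intro nn_integral_eq_integral P.integrable_const_bound[where B = 1]) (auto split: split_indicator)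
    finally show "P.prob ?C = (\<integral>\<omega>. min 1 (max 0 (k A (r (E \<omega>)))) * indicator ?D \<omega> \<partial>P)"
      by (subst (asm) ennreal_inj) (auto intro!: integral_nonneg_AE)
  qed
  then show ?thesis by (simp add: F_def)
qed

section \<open>Factorization of the weight\<close>

lemma fs_ancestor_iff:
  assumes T: "T > 0"
  shows "fs_ancestor T (i, j) (k, l) \<longleftrightarrow>
    real j * T / 2 ^ i \<le> real l * T / 2 ^ k \<and> (real l + 1) * T / 2 ^ k \<le> (real j + 1) * T / 2 ^ i"
proof -
  have "real l * T / 2 ^ k \<le> (real l + 1) * T / 2 ^ k"
    using T by (intro divide_right_mono mult_right_mono) auto
  then show ?thesis by (auto simp: fs_ancestor_def fs_support_def)
qed

text \<open>A support of level \<open>i\<close> has length T / 2^i, so inclusion orders the levels;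
  at equal level both end points coincide.\<close>

lemma fs_ancestor_level:
  assumes T: "T > 0" and anc: "fs_ancestor T p q"
  shows "fst p \<le> fst q" "fst p = fst q \<Longrightarrow> p = q"
proof -
  obtain i j k l where p: "p = (i, j)" and q: "q = (k, l)"
    by (cases p; cases q)
  note * = anc[unfolded p q fs_ancestor_iff[OF T]]
  have "T / 2 ^ k \<le> T / 2 ^ i"
    using conjunct1[OF *] conjunct2[OF *] by (simp add: add_divide_distrib distrib_right)
  then have "(2::real) ^ i \<le> 2 ^ k"
    using T by (simp add: field_simps)
  then show "fst p \<le> fst q" by (simp add: p q)
  show "p = q" if "fst p = fst q"
    using * T that by (simp add: p q divide_le_cancel mult_le_cancel_right)
qed

lemma fs_ancestor_refl: "fs_ancestor T p p"
  by (simp add: fs_ancestor_def)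

lemma fs_ancestor_trans: "fs_ancestor T p q \<Longrightarrow> fs_ancestor T q r \<Longrightarrow> fs_ancestor T p r"
  by (auto simp: fs_ancestor_def)

text \<open>In the tree, \<open>n\<close> is where the branch towards \<open>p\<close> leaves the
  ancestors of \<open>q\<close>. Minimizing the level finds it: a proper ancestor of
  \<open>n\<close> is still an ancestor of \<open>p\<close> and has smaller level, so it cannot
  separate.\<close>

lemma ex_top_separating_ancestor:
  assumes T: "T > 0" and p: "snd p < 2 ^ fst p" and pq: "\<not> fs_ancestor T p q"
  obtains n where "snd n < 2 ^ fst n" "fs_ancestor T n p" "\<not> fs_ancestor T n q"
    "\<And>m. snd m < 2 ^ fst m \<Longrightarrow> fs_ancestor T m n \<Longrightarrow> m \<noteq> n \<Longrightarrow> fs_ancestor T m q"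
proof -
  let ?P = "\<lambda>n. snd n < 2 ^ fst n \<and> fs_ancestor T n p \<and> \<not> fs_ancestor T n q"
  have "?P p" using p pq fs_ancestor_refl by blast
  from ex_has_least_nat[of ?P, OF this, of fst]
  obtain n where n: "?P n" "\<And>m. ?P m \<Longrightarrow> fst n \<le> fst m"
    by blast
  have "fs_ancestor T m q" if m: "snd m < 2 ^ fst m" "fs_ancestor T m n" "m \<noteq> n" for m
  proof (rule ccontr)
    assume "\<not> fs_ancestor T m q"
    then have "?P m" using m n(1) fs_ancestor_trans by blast
    then have "fst n \<le> fst m" by (rule n(2))
    then show False
      using fs_ancestor_level[OF T m(2)] m(3) by simp
  qed
  then show ?thesis using that n(1) by blast
qed

section \<open>Weights of parts of the time interval\<close>

definition fs_path :: "real \<Rightarrow> real \<Rightarrow> real \<Rightarrow> nat \<Rightarrow> (nat \<times> nat \<Rightarrow> real) \<Rightarrow> real \<Rightarrow> real" where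
  "fs_path T u v N c = fs_partial T u v (\<lambda>i j. c (i, j)) N"

definition path_weight ::
  "(real \<Rightarrow> real) \<Rightarrow> real \<Rightarrow> real \<Rightarrow> real \<Rightarrow> nat \<Rightarrow> real set \<Rightarrow> (nat \<times> nat \<Rightarrow> real) \<Rightarrow> real" where
  "path_weight F T u v N S c = exp (- 1 / 2 * (LBINT s:S. F (fs_path T u v N c s)))"

lemma continuous_on_fs_path:
  assumes "T > 0" shows "continuous_on S (fs_path T u v N c)"
  unfolding fs_path_def fs_partial_def
  using assms by (intro continuous_intros continuous_on_fs_fun) auto

lemma fs_path_cong:
  assumes "\<And>p. p \<in> fs_index N \<Longrightarrow> fs_fun T (fst p) (snd p) s = 0 \<or> c p = c' p"
  shows "fs_path T u v N c s = fs_path T u v N c' s"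
proof -
  have "c (i, j) * fs_fun T i j s = c' (i, j) * fs_fun T i j s" if "i \<le> N" "j < 2 ^ i" for i j
    using assms[of "(i, j)"] that by (auto simp: fs_index_def)
  then show ?thesis
    unfolding fs_path_def fs_partial_def by (auto intro!: sum.cong)
qed

text \<open>Locality: only coefficients whose basis functions are active somewhere in
  \<open>S\<close> influence the weight over \<open>S\<close>.\<close>

lemma path_weight_cong:
  assumes "\<And>p s. p \<in> fs_index N \<Longrightarrow> s \<in> S \<Longrightarrow> fs_fun T (fst p) (snd p) s = 0 \<or> c p = c' p"
  shows "path_weight F T u v N S c = path_weight F T u v N S c'"
proof -
  have "indicator S s *\<^sub>R F (fs_path T u v N c s) = indicator S s *\<^sub>R F (fs_path T u v N c' s)" for s
    using assms fs_path_cong[of N T s c c' u v] by (cases "s \<in> S") auto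
  then show ?thesis
    unfolding path_weight_def set_lebesgue_integral_def by presburger
qed

lemma path_weight_pos: "0 < path_weight F T u v N S c"
  by (simp add: path_weight_def)

lemma set_integrable_fs_path:
  fixes F :: "real \<Rightarrow> real"
  assumes T: "T > 0" and F: "continuous_on UNIV F" and S: "S \<in> sets borel" "S \<subseteq> {0..T}"
  shows "set_integrable lborel S (\<lambda>s. F (fs_path T u v N c s))"
proof -
  have "continuous_on {0..T} (\<lambda>s. F (fs_path T u v N c s))"
    by (rule continuous_on_compose2[OF F continuous_on_fs_path[OF T]]) auto
  then have "set_integrable lborel {0..T} (\<lambda>s. F (fs_path T u v N c s))"
    by (rule borel_integrable_atLeastAtMost')
  then show ?thesis
    by (rule set_integrable_subset) (use S in auto)
qed

text \<open>The bound is uniform in the coefficients and in \<open>S\<close>; since \<open>C\<close>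
  is nonnegative, the length of \<open>S\<close> may be replaced by \<open>T\<close>.\<close>

lemma path_weight_le:
  assumes T: "T > 0" and F: "continuous_on UNIV F" "\<And>x. - C \<le> F x" and S: "S \<in> sets borel" "S \<subseteq> {0..T}"
    and C: "C \<ge> 0"
  shows "path_weight F T u v N S c \<le> exp (C * T / 2)"
proof -
  have fin: "emeasure lborel S < \<infinity>"
  proof -
    have "emeasure lborel S \<le> emeasure lborel {0..T}" using S by (intro emeasure_mono) auto
    also have "\<dots> < \<infinity>" using T by simp
    finally show ?thesis .
  qed
  have "measure lborel S \<le> measure lborel {0..T}"
    using S T by (intro measure_mono_fmeasurable) (auto simp: fmeasurable_def)
  then have "measure lborel S \<le> T" using T by simp
  then have "- C * T \<le> - C * measure lborel S" using C by (simp add: mult_left_mono)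
  also have "\<dots> = (LBINT s:S. - C)"
    using S fin by (simp add: set_integral_const)
  also have "\<dots> \<le> (LBINT s:S. F (fs_path T u v N c s))"
    using S fin F(2) by (intro set_integral_mono set_integrable_fs_path[OF T F(1) S])
      (auto simp: set_integrable_def)
  finally show ?thesis by (simp add: path_weight_def)
qed

lemma measurable_path_weight:
  assumes T: "T > 0" and F: "continuous_on UNIV F" and S [measurable]: "S \<in> sets borel"
    and c: "\<And>p. p \<in> fs_index N \<Longrightarrow> (\<lambda>z. c z p) \<in> borel_measurable M"
  shows "(\<lambda>z. path_weight F T u v N S (c z)) \<in> borel_measurable M"
proof -
  have [measurable]: "F \<in> borel_measurable borel"
    using F by (rule borel_measurable_continuous_onI)
  have [measurable]: "fs_fun T i j \<in> borel_measurable borel" for i j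
    by (rule borel_measurable_continuous_onI) (rule continuous_on_fs_fun[OF T])
  have [measurable]: "(\<lambda>x. c (fst x) (i, j)) \<in> borel_measurable (M \<Otimes>\<^sub>M lborel)" if "i \<in> {..N}" "j \<in> {..<2 ^ i}" for i j
    using c[of "(i, j)"] that by (intro measurable_compose[OF measurable_fst]) (auto simp: fs_index_def)
  have "(\<lambda>x. \<Sum>i\<le>N. \<Sum>j<2 ^ i. c (fst x) (i, j) * fs_fun T i j (snd x)) \<in> borel_measurable (M \<Otimes>\<^sub>M lborel)"
    by (intro borel_measurable_sum borel_measurable_times) measurable
  then have [measurable]: "(\<lambda>x. fs_path T u v N (c (fst x)) (snd x)) \<in> borel_measurable (M \<Otimes>\<^sub>M lborel)"
    unfolding fs_path_def fs_partial_def by measurable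
  have "(\<lambda>z. LBINT s:S. F (fs_path T u v N (c z) s)) \<in> borel_measurable M"
    unfolding set_lebesgue_integral_def
    by (rule lborel.borel_measurable_lebesgue_integral) (simp add: split_beta')
  then show ?thesis unfolding path_weight_def by measurable
qed

lemma path_weight_split:
  assumes T: "T > 0" and F: "continuous_on UNIV F" and S: "S \<in> sets borel" "S \<subseteq> {0..T}"
  shows "path_weight F T u v N {0..T} c = path_weight F T u v N S c * path_weight F T u v N ({0..T} - S) c"
proof -
  have "(LBINT s:S \<union> ({0..T} - S). F (fs_path T u v N c s))
      = (LBINT s:S. F (fs_path T u v N c s)) + (LBINT s:{0..T} - S. F (fs_path T u v N c s))"
    using S by (intro set_integral_Un set_integrable_fs_path[OF T F]) auto
  moreover have "S \<union> ({0..T} - S) = {0..T}" using S by auto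
  ultimately show ?thesis
    unfolding path_weight_def by (simp add: exp_add[symmetric] algebra_simps)
qed

text \<open>The truncated path always runs from \<open>u\<close> to \<open>v\<close>, as all basis
  functions vanish at the end points, so the potential terms form a constant.\<close>

lemma bridge_weight_eq:
  assumes T: "T > 0"
  shows "bridge_weight T u v b N X = exp (drift_potential b v - drift_potential b u)
    * path_weight (\<lambda>x. (b x)\<^sup>2 + deriv b x) T u v N {0..T} (\<lambda>(i, j). fs_coeff T X i j)"
proof -
  let ?G = "\<lambda>s. (b (truncated_path T u v N X s))\<^sup>2 + deriv b (truncated_path T u v N X s)"
  have "(LBINT s=ereal 0..ereal T. ?G s) = (LBINT s:{0..T}. ?G s)"
    using T by (intro interval_integral_Icc) auto
  then show ?thesis
    using fs_partial_ends[OF T]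
    by (simp add: bridge_weight_def path_weight_def fs_path_def truncated_path_def exp_add[symmetric] exp_diff exp_minus field_simps)
qed

lemma C1_real_deriv_continuous:
  fixes b :: "real \<Rightarrow> real"
  assumes "b C1_differentiable_on UNIV"
  shows "continuous_on UNIV b" "continuous_on UNIV (deriv b)"
proof -
  obtain D where D: "\<And>x. (b has_vector_derivative D x) (at x)" "continuous_on UNIV D"
    using assms by (auto simp: C1_differentiable_on_def)
  have b: "(b has_real_derivative D x) (at x)" for x
    using D(1)[of x] by (simp add: has_real_derivative_iff_has_vector_derivative)
  then show "continuous_on UNIV b"
    by (meson DERIV_isCont continuous_at_imp_continuous_on)
  have "deriv b = D" using b by (auto intro!: DERIV_imp_deriv)
  then show "continuous_on UNIV (deriv b)" using D(2) by simp
qed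

theorem propositionA1:
  fixes T u v :: real and b :: "real \<Rightarrow> real" and N i j k l :: nat
    and Q :: "(real \<Rightarrow> real) measure"
  assumes "T > 0"
    and "b C1_differentiable_on UNIV"
    and "bdd_below (range (\<lambda>x. (b x)\<^sup>2 + deriv b x))"
    and "brownian_bridge_law T u v Q"
    and "i \<le> N" and "k \<le> N"
    and "j < 2 ^ i" and "l < 2 ^ k"
    and "interior (fs_support T i j) \<inter> interior (fs_support T k l) = {}"
  shows "cond_indep_var (approx_bridge T u v b N Q)
           (generated_by (approx_bridge T u v b N Q) (common_ancestors T (i, j) (k, l))
              (\<lambda>(h, d) X. fs_coeff T X h d))
           (\<lambda>X. fs_coeff T X i j) (\<lambda>X. fs_coeff T X k l)"
proof -
  note T = \<open>T > 0\<close>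
  define F where "F = (\<lambda>x. (b x)\<^sup>2 + deriv b x)"
  have F: "continuous_on UNIV F"
    unfolding F_def using C1_real_deriv_continuous[OF \<open>b C1_differentiable_on UNIV\<close>]
    by (intro continuous_intros)
  obtain C where C: "C \<ge> 0" "\<And>x. - C \<le> F x"
  proof -
    obtain m where m: "\<And>x. m \<le> F x"
      using assms(3) unfolding F_def bdd_below_def by blast
    \<comment> \<open>Passing to -|m| makes the constant nonnegative, as
      \<open>path_weight_le\<close> requires.\<close>
    have "- \<bar>m\<bar> \<le> F x" for x using m[of x] by linarith
    then show thesis by (rule that[OF abs_ge_zero])
  qed
  define p q where "p = (i, j)" and "q = (k, l)"
  have "\<not> fs_ancestor T p q"
    using assms(9) fs_interiors_disjoint_iff[OF T] unfolding p_def q_def by blast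
  then obtain n where n: "snd n < 2 ^ fst n" "fs_ancestor T n p" "\<not> fs_ancestor T n q"
    and n_top: "\<And>m. snd m < 2 ^ fst m \<Longrightarrow> fs_ancestor T m n \<Longrightarrow> m \<noteq> n \<Longrightarrow> fs_ancestor T m q"
    using ex_top_separating_ancestor[OF T, of p q] \<open>j < 2 ^ i\<close> by (auto simp: p_def)
  \<comment> \<open>By minimality of \<open>n\<close>, on its support a basis function outside \<open>D \<union> A\<close> vanishes.\<close>
  define D where "D = {m \<in> fs_index N. fs_ancestor T n m}"
  define E where "E = fs_index N - D"
  define A where "A = common_ancestors T p q"
  \<comment> \<open>The open support: descendants of \<open>n\<close> vanish off it, boundary
    included, and the nested-or-disjoint alternative is stated for interiors.\<close>
  define S where "S = interior (fs_support T (fst n) (snd n))"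
  have pD: "p \<in> D" and qE: "q \<in> E"
    using n assms(5-8) by (auto simp: D_def E_def p_def q_def fs_index_def)
  \<comment> \<open>An ancestor of \<open>q\<close> cannot descend from \<open>n\<close>, since
    \<open>n\<close> would then be an ancestor of \<open>q\<close>; its level is at most
    \<open>i\<close>, hence at most \<open>N\<close>.\<close>
  have AE: "A \<subseteq> E"
  proof
    fix m assume m: "m \<in> A"
    obtain h d where hd: "m = (h, d)" by (cases m)
    have "d < 2 ^ h" "fs_ancestor T (h, d) p" "fs_ancestor T (h, d) q"
      using m by (auto simp: A_def common_ancestors_def hd)
    moreover have "h \<le> i"
      using fs_ancestor_level(1)[OF T \<open>fs_ancestor T (h, d) p\<close>] by (simp add: p_def)
    moreover have "\<not> fs_ancestor T n (h, d)"
      using n(3) fs_ancestor_trans[OF _ \<open>fs_ancestor T (h, d) q\<close>] by blast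
    ultimately show "m \<in> E"
      using \<open>i \<le> N\<close> unfolding E_def D_def fs_index_def hd by auto
  qed
  have S: "S \<in> sets borel" "S \<subseteq> {0..T}"
  proof -
    show "S \<in> sets borel" by (simp add: S_def)
    have "real (snd n) * T / 2 ^ fst n \<in> {0..T}" "real (snd n + 1) * T / 2 ^ fst n \<in> {0..T}"
      using n(1) by (intro dyadic_point_in[OF T]; simp)+
    then show "S \<subseteq> {0..T}" unfolding S_def interior_fs_support by (auto simp: add.commute)
  qed
  \<comment> \<open>A function active on \<open>S\<close> overlaps the support of \<open>n\<close>,
    hence is an ancestor or a descendant of \<open>n\<close>. Proper ancestors of \<open>n\<close>
    are ancestors of \<open>q\<close> by the choice of \<open>n\<close>, and of \<open>p\<close>
    through \<open>n\<close>.\<close>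
  have on_S: "fs_fun T (fst m) (snd m) s = 0 \<or> m \<in> D \<union> A" if m: "m \<in> fs_index N" and s: "s \<in> S" for m s
  proof (cases "s \<in> interior (fs_support T (fst m) (snd m))")
    case True
    then have "interior (fs_support T (fst m) (snd m)) \<inter> interior (fs_support T (fst n) (snd n)) \<noteq> {}"
      using s by (auto simp: S_def)
    then have "fs_ancestor T m n \<or> fs_ancestor T n m"
      unfolding fs_interiors_disjoint_iff[OF T] by simp
    moreover have "m \<in> A" if "fs_ancestor T m n" "m \<noteq> n"
      using n_top[OF _ that] fs_ancestor_trans[OF that(1) n(2)] m
      by (auto simp: A_def common_ancestors_def fs_index_def)
    moreover have "m \<in> D" if "fs_ancestor T n m" using that m by (simp add: D_def)
    ultimately show ?thesis using fs_ancestor_refl by (cases "m = n") auto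
  qed (use fs_fun_support[OF T] in auto)
  have off_S: "fs_fun T (fst m) (snd m) s = 0 \<or> m \<in> E" if m: "m \<in> fs_index N" and s: "s \<in> {0..T} - S" for m s
  proof (cases "m \<in> D")
    case True
    then have "interior (fs_support T (fst m) (snd m)) \<subseteq> S"
      unfolding S_def by (intro interior_mono) (simp add: D_def fs_ancestor_def)
    then show ?thesis using s fs_fun_support[OF T] by blast
  qed (use m in \<open>simp add: E_def\<close>)

  define X where "X = (\<lambda>m \<omega>. fs_coeff T \<omega> (fst m) (snd m))"
  define V where "V = (\<lambda>\<omega>. \<lambda>m\<in>D. X m \<omega>)"
  define Y where "Y = (\<lambda>\<omega>. \<lambda>m\<in>E. X m \<omega>)"
  define r where "r = (\<lambda>e :: nat \<times> nat \<Rightarrow> real. restrict e A)"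
  \<comment> \<open>The coefficients outside \<open>D\<close> and \<open>A\<close> are set to 0;
    their basis functions vanish on \<open>S\<close>, so the default is harmless. Bounds and
    positivity then hold for all arguments.\<close>
  define f where "f = (\<lambda>a d. path_weight F T u v N S (\<lambda>m. if m \<in> D then d m else if m \<in> A then a m else 0))"
  define K where "K = exp (drift_potential b v - drift_potential b u)"
  define g where "g = (\<lambda>e. K * path_weight F T u v N ({0..T} - S) (\<lambda>m. if m \<in> E then e m else 0))"
  have K: "K > 0" by (simp add: K_def)
  have weight: "bridge_weight T u v b N \<omega> = f (r (Y \<omega>)) (V \<omega>) * g (Y \<omega>)" for \<omega>
  proof -
    have "f (r (Y \<omega>)) (V \<omega>) = path_weight F T u v N S (\<lambda>m. X m \<omega>)"
      unfolding f_def using AE on_S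
      by (intro path_weight_cong) (auto simp: r_def Y_def V_def)
    moreover have "path_weight F T u v N ({0..T} - S) (\<lambda>m. if m \<in> E then Y \<omega> m else 0)
        = path_weight F T u v N ({0..T} - S) (\<lambda>m. X m \<omega>)"
      using off_S by (intro path_weight_cong) (auto simp: Y_def)
    moreover have "bridge_weight T u v b N \<omega> = K * path_weight F T u v N {0..T} (\<lambda>m. X m \<omega>)"
      unfolding bridge_weight_eq[OF T] K_def F_def X_def by (simp add: case_prod_beta')
    ultimately show ?thesis
      unfolding path_weight_split[OF T F S] g_def by simp
  qed

  note Q = bridge_fs_coeff_indep[OF assms(4) T]
  interpret Q: prob_space Q by (rule Q(1))
  \<comment> \<open>\<open>A\<close> lies in \<open>E\<close>, so the common ancestors sit on the
    side of \<open>Y\<close> and are recovered from it by \<open>r\<close>.\<close>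
  have ind: "Q.indep_var (PiM E (\<lambda>_. borel)) Y (PiM D (\<lambda>_. borel)) V"
    unfolding Y_def V_def X_def
    by (rule Q.indep_var_restrict[OF Q(3)]) (auto simp: D_def E_def)
  have "cond_indep_var (density Q (\<lambda>\<omega>. ennreal (f (r (Y \<omega>)) (V \<omega>) * g (Y \<omega>)
        / (\<integral>\<omega>. f (r (Y \<omega>)) (V \<omega>) * g (Y \<omega>) \<partial>Q))))
      (vimage_algebra (space Q) (\<lambda>\<omega>. r (Y \<omega>)) (PiM A (\<lambda>_. borel)))
      (\<lambda>\<omega>. V \<omega> p) (\<lambda>\<omega>. Y \<omega> q)"
  proof (rule Q.cond_indep_var_density[OF ind])
    show "r \<in> measurable (PiM E (\<lambda>_. borel)) (PiM A (\<lambda>_. borel))"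
      unfolding r_def by (rule measurable_restrict_subset[OF AE])
    show "(\<lambda>(a, d). f a d) \<in> borel_measurable (PiM A (\<lambda>_. borel) \<Otimes>\<^sub>M PiM D (\<lambda>_. borel))"
      unfolding f_def case_prod_beta'
    proof (rule measurable_path_weight[OF T F S(1)])
      fix m
      show "(\<lambda>z. if m \<in> D then snd z m else if m \<in> A then fst z m else 0)
          \<in> borel_measurable (PiM A (\<lambda>_. borel) \<Otimes>\<^sub>M PiM D (\<lambda>_. borel))"
        by (cases "m \<in> D"; cases "m \<in> A") simp_all
    qed
    have "(\<lambda>e. path_weight F T u v N ({0..T} - S) (\<lambda>m. if m \<in> E then e m else 0))
        \<in> borel_measurable (PiM E (\<lambda>_. borel))"
    proof (rule measurable_path_weight[OF T F])
      show "{0..T} - S \<in> sets borel" using S(1) by simp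
      show "(\<lambda>e. if m \<in> E then e m else 0) \<in> borel_measurable (PiM E (\<lambda>_. borel))" for m
        by (cases "m \<in> E") simp_all
    qed
    then show "g \<in> borel_measurable (PiM E (\<lambda>_. borel))" unfolding g_def by simp
    show "(\<lambda>d. d p) \<in> borel_measurable (PiM D (\<lambda>_. borel))" "(\<lambda>e. e q) \<in> borel_measurable (PiM E (\<lambda>_. borel))"
      using pD qE by (simp_all add: measurable_component_singleton)
    show "0 < f a d" "0 < g e" for a d e using K by (simp_all add: f_def g_def path_weight_pos)
    show "f a d \<le> exp (C * T / 2)" for a d
      unfolding f_def by (rule path_weight_le[OF T F C(2) S C(1)])
    show "g e \<le> K * exp (C * T / 2)" for e
      unfolding g_def using K S(1)
      by (intro mult_left_mono path_weight_le[OF T F C(2) _ _ C(1)]) auto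
  qed
  moreover have "(\<lambda>\<omega>. V \<omega> p) = (\<lambda>\<omega>. fs_coeff T \<omega> i j)" "(\<lambda>\<omega>. Y \<omega> q) = (\<lambda>\<omega>. fs_coeff T \<omega> k l)"
    using pD qE by (simp_all add: V_def Y_def X_def) (simp_all add: p_def q_def)
  moreover have "vimage_algebra (space Q) (\<lambda>\<omega>. r (Y \<omega>)) (PiM A (\<lambda>_. borel))
      = generated_by (approx_bridge T u v b N Q) (common_ancestors T (i, j) (k, l)) (\<lambda>(h, d) X. fs_coeff T X h d)"
  proof -
    have "r (Y \<omega>) = (\<lambda>m\<in>A. X m \<omega>)" for \<omega>
      using AE by (auto simp: r_def Y_def restrict_def fun_eq_iff)
    then show ?thesis
      unfolding generated_by_def approx_bridge_def A_def p_def q_def X_def by (simp add: case_prod_beta')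
  qed
  ultimately show ?thesis
    unfolding approx_bridge_def weight by simp
qed

end
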